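(* For every positive integer $k$, in $\mathbb C[[\mathbf t]]$, \[ \sum_{n\ge0}\sum_{\underline\mu\vdash n}\frac{\mathrm{sroots}_k^{B_n}(\underline\mu)}{|Z_{\underline\mu}|}\,\mathbf t^{\mathbf c(\underline\mu)}=\exp\Big(\sum_{j\ge1}\sum_{\theta\in\mathbb Z_2}\sum_{\substack{h\mid k\\ \gcd(h,j)=1}}\frac{t_{j,\theta}^{jk/h}}{2jk/h}\,\mathrm{sroots}_h^{\mathbb Z_2}(\theta)\Big), \] where $h$ runs over positive divisors of $k$.
   Context: $B_n$ is the group of bijections $w$ of $\{\pm1,\dots,\pm n\}$ with $w(-i)=-w(i)$; $\chi(w)=\prod_{i=1}^n\mathrm{sign}(w(i))$, and $\mathrm{sroots}_k^{B_n}(y)=\sum_{x\in B_n,\,x^k=y}\chi(x)$. Cycles: if $c$ is a cycle of $w$ on $\{\pm1,\dots,\pm n\}$ of length $\ell$, so is $\bar c$ (negated entries); if $c\ne\bar c$, $c\bar c$ is a cycle of length $\ell$ and class $+1$; if $c=\bar c$, a cycle of length $\ell/2$ and class $-1$. Conjugacy classes are indexed by bipartitions $\underline\mu=(\mu^+,\mu^-)\vdash n$ ($\mu^\theta$ = lengths of cycles of class $\theta$); $b_{j,\theta}$ is the number of parts $j$ of $\mu^\theta$; $\mathbf t^{\mathbf c(\underline\mu)}=\prod_{j,\theta}t_{j,\theta}^{jb_{j,\theta}}$ with indeterminates $t_{j,\theta}$. $\mathrm{sroots}_k^{B_n}(\underline\mu)$ is the value at an element of class $\underline\mu$, $|Z_{\underline\mu}|$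 its centralizer order. $\mathbb Z_2=\{\pm1\}$ and $\mathrm{sroots}_h^{\mathbb Z_2}(\theta)=\sum_{\varepsilon\in\mathbb Z_2,\,\varepsilon^h=\theta}\varepsilon$. *)

theory Defs
  imports
    "HOL-Analysis.Infinite_Sum"
    "HOL-Library.Poly_Mapping"
    "HOL-Library.Multiset"
    "HOL-Combinatorics.Orbits"
begin

section \<open>Formal power series in arbitrarily many indeterminates\<close>

text \<open>
  Monomials in indeterminates indexed by \<^typ>\<open>'v\<close> are finitely supported exponent vectors
  \<^typ>\<open>'v \<Rightarrow>\<^sub>0 nat\<close>; a series is an arbitrary function from monomials to coefficients.
\<close>

typedef (overloaded) ('v, 'a) mfps = "UNIV :: (('v \<Rightarrow>\<^sub>0 nat) \<Rightarrow> 'a) set"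
  morphisms mfps_nth Abs_mfps
  by simp

lemma mfps_nth_Abs [simp]: "mfps_nth (Abs_mfps f) = f"
  by (simp add: Abs_mfps_inverse)

lemma mfps_eqI: "(\<And>m. mfps_nth F m = mfps_nth G m) \<Longrightarrow> F = G"
  by (metis ext mfps_nth_inject)

definition splittings :: "('v \<Rightarrow>\<^sub>0 nat) \<Rightarrow> (('v \<Rightarrow>\<^sub>0 nat) \<times> ('v \<Rightarrow>\<^sub>0 nat)) set" where
  "splittings m = {(a, b). a + b = m}"

lemma finite_splittings [simp]:
  fixes m :: "'v \<Rightarrow>\<^sub>0 nat"
  shows "finite (splittings m)"
proof -
  let ?A = "{a. \<exists>b. a + b = m}"
  let ?r = "\<lambda>a::'v \<Rightarrow>\<^sub>0 nat. restrict (Poly_Mapping.lookup a) (Poly_Mapping.keys m)"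
  have le: "Poly_Mapping.lookup a v \<le> Poly_Mapping.lookup m v" if "a \<in> ?A" for a :: "'v \<Rightarrow>\<^sub>0 nat" and v
    using that by (auto simp: lookup_add)
  have "?r ` ?A \<subseteq> (\<Pi>\<^sub>E v\<in>Poly_Mapping.keys m. {..Poly_Mapping.lookup m v})"
    using le by auto
  moreover have "finite (\<Pi>\<^sub>E v\<in>Poly_Mapping.keys m. {..Poly_Mapping.lookup m v})"
    by (intro finite_PiE) auto
  ultimately have "finite (?r ` ?A)"
    by (rule finite_subset)
  moreover have "inj_on ?r ?A"
  proof (rule inj_onI)
    fix a b assume a: "a \<in> ?A" and b: "b \<in> ?A" and eq: "?r a = ?r b"
    show "a = b"
    proof (rule poly_mapping_eqI)
      fix v
      show "Poly_Mapping.lookup a v = Poly_Mapping.lookup b v"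
      proof (cases "v \<in> Poly_Mapping.keys m")
        case True
        then show ?thesis using fun_cong[OF eq, of v] by simp
      next
        case False
        then have "Poly_Mapping.lookup m v = 0" by (simp add: in_keys_iff)
        then show ?thesis using le[OF a, of v] le[OF b, of v] by simp
      qed
    qed
  qed
  ultimately have fin: "finite ?A"
    by (rule finite_imageD)
  have "splittings m \<subseteq> (\<lambda>a. (a, m - a)) ` ?A"
    by (auto simp: splittings_def)
  then show ?thesis
    using fin by (meson finite_imageI finite_subset)
qed

instantiation mfps :: (type, comm_ring_1) comm_ring_1
begin

definition zero_mfps :: "('a, 'b) mfps" where
  "0 = Abs_mfps (\<lambda>m. 0)"

definition one_mfps :: "('a, 'b) mfps" where
  "1 = Abs_mfps (\<lambda>m. if m = 0 then 1 else 0)"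

definition plus_mfps :: "('a, 'b) mfps \<Rightarrow> ('a, 'b) mfps \<Rightarrow> ('a, 'b) mfps" where
  "F + G = Abs_mfps (\<lambda>m. mfps_nth F m + mfps_nth G m)"

definition uminus_mfps :: "('a, 'b) mfps \<Rightarrow> ('a, 'b) mfps" where
  "- F = Abs_mfps (\<lambda>m. - mfps_nth F m)"

definition minus_mfps :: "('a, 'b) mfps \<Rightarrow> ('a, 'b) mfps \<Rightarrow> ('a, 'b) mfps" where
  "F - G = Abs_mfps (\<lambda>m. mfps_nth F m - mfps_nth G m)"

definition times_mfps :: "('a, 'b) mfps \<Rightarrow> ('a, 'b) mfps \<Rightarrow> ('a, 'b) mfps" where
  "F * G = Abs_mfps (\<lambda>m. \<Sum>(a, b)\<in>splittings m. mfps_nth F a * mfps_nth G b)"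

instance
proof
  fix F G H :: "('a, 'b) mfps"
  show "F * G = G * F"
  proof (rule mfps_eqI)
    fix m
    show "mfps_nth (F * G) m = mfps_nth (G * F) m"
      unfolding times_mfps_def mfps_nth_Abs
      by (rule sum.reindex_bij_witness[of _ prod.swap prod.swap])
        (auto simp: splittings_def ac_simps)
  qed
  show "F * G * H = F * (G * H)"
  proof (rule mfps_eqI)
    fix m
    have "mfps_nth (F * G * H) m =
        (\<Sum>(p, c)\<in>splittings m. \<Sum>(a, b)\<in>splittings p. mfps_nth F a * mfps_nth G b * mfps_nth H c)"
      by (simp add: times_mfps_def sum_distrib_right case_prod_unfold)
    also have "\<dots> = (\<Sum>((p, c), (a, b))\<in>Sigma (splittings m) (\<lambda>(p, c). splittings p).
        mfps_nth F a * mfps_nth G b * mfps_nth H c)"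
      by (subst sum.Sigma[symmetric]) (auto simp: case_prod_unfold)
    also have "\<dots> = (\<Sum>((a, q), (b, c))\<in>Sigma (splittings m) (\<lambda>(a, q). splittings q).
        mfps_nth F a * (mfps_nth G b * mfps_nth H c))"
      by (rule sum.reindex_bij_witness[of _
            "\<lambda>((a, q), (b, c)). ((a + b, c), (a, b))" "\<lambda>((p, c), (a, b)). ((a, b + c), (b, c))"])
        (auto simp: splittings_def ac_simps)
    also have "\<dots> = (\<Sum>(a, q)\<in>splittings m. \<Sum>(b, c)\<in>splittings q.
        mfps_nth F a * (mfps_nth G b * mfps_nth H c))"
      by (subst sum.Sigma[symmetric]) (auto simp: case_prod_unfold)
    also have "\<dots> = mfps_nth (F * (G * H)) m"
      by (simp add: times_mfps_def sum_distrib_left case_prod_unfold)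
    finally show "mfps_nth (F * G * H) m = mfps_nth (F * (G * H)) m" .
  qed
  show "1 * F = F"
  proof (rule mfps_eqI)
    fix m
    have "mfps_nth (1 * F) m =
        (\<Sum>(a, b)\<in>splittings m. (if a = 0 then 1 else 0) * mfps_nth F b)"
      by (simp add: times_mfps_def one_mfps_def)
    also have "\<dots> = (\<Sum>(a, b)\<in>{(0 :: 'a \<Rightarrow>\<^sub>0 nat, m)}. (if a = 0 then 1 else 0) * mfps_nth F b)"
      by (rule sum.mono_neutral_right, simp)
        (auto simp: splittings_def split: if_splits)
    finally show "mfps_nth (1 * F) m = mfps_nth F m" by simp
  qed
  show "(F + G) * H = F * H + G * H"
    by (rule mfps_eqI)
      (simp add: times_mfps_def plus_mfps_def distrib_right sum.distrib case_prod_unfold)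
  have "mfps_nth (0 :: ('a, 'b) mfps) 0 \<noteq> mfps_nth 1 0"
    by (simp add: zero_mfps_def one_mfps_def)
  then show "(0 :: ('a, 'b) mfps) \<noteq> 1" by auto
qed (auto intro!: mfps_eqI simp: zero_mfps_def plus_mfps_def uminus_mfps_def minus_mfps_def)

end

lemma mfps_nth_sum: "mfps_nth (sum f A) m = (\<Sum>i\<in>A. mfps_nth (f i) m)"
  by (induction A rule: infinite_finite_induct) (simp_all add: zero_mfps_def plus_mfps_def)

text \<open>
  The usual topology on a power series ring: the coefficients carry the discrete topology and
  convergence is coefficientwise, so that each coefficient of a convergent family is eventually
  constant.
\<close>

instantiation mfps :: (type, type) t2_space
begin

definition open_mfps :: "('a, 'b) mfps set \<Rightarrow> bool" where
  "open U \<longleftrightarrow> (\<forall>F\<in>U. \<exists>M. finite M \<and> {G. \<forall>m\<in>M. mfps_nth G m = mfps_nth F m} \<subseteq> U)"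

instance
proof
  show "open (UNIV :: ('a, 'b) mfps set)"
    by (auto simp: open_mfps_def intro: exI[of _ "{}"])
next
  fix U V :: "('a, 'b) mfps set"
  assume U: "open U" and V: "open V"
  show "open (U \<inter> V)"
    unfolding open_mfps_def
  proof
    fix F assume "F \<in> U \<inter> V"
    with U V obtain M N where
      "finite M" "{G. \<forall>m\<in>M. mfps_nth G m = mfps_nth F m} \<subseteq> U"
      "finite N" "{G. \<forall>m\<in>N. mfps_nth G m = mfps_nth F m} \<subseteq> V"
      unfolding open_mfps_def by (meson IntD1 IntD2)
    then show "\<exists>M. finite M \<and> {G. \<forall>m\<in>M. mfps_nth G m = mfps_nth F m} \<subseteq> U \<inter> V"
      by (intro exI[of _ "M \<union> N"]) auto
  qed
next
  fix K :: "('a, 'b) mfps set set"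
  assume "\<forall>U\<in>K. open U"
  then show "open (\<Union>K)"
    unfolding open_mfps_def by (meson Sup_upper UnionE subset_trans)
next
  fix F G :: "('a, 'b) mfps"
  assume "F \<noteq> G"
  then obtain m where m: "mfps_nth F m \<noteq> mfps_nth G m"
    using mfps_eqI by blast
  have "open {H :: ('a, 'b) mfps. mfps_nth H m = c}" for c
    by (auto simp: open_mfps_def intro!: exI[of _ "{m}"])
  then show "\<exists>U V. open U \<and> open V \<and> F \<in> U \<and> G \<in> V \<and> U \<inter> V = {}"
    using m
    by (intro exI[of _ "{H. mfps_nth H m = mfps_nth F m}"]
        exI[of _ "{H. mfps_nth H m = mfps_nth G m}"]) auto
qed

end

lemma has_sum_mfps:
  fixes f :: "'i \<Rightarrow> ('v, 'a::comm_ring_1) mfps"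
  assumes fin: "\<And>m. finite {i\<in>A. mfps_nth (f i) m \<noteq> 0}"
  shows "(f has_sum Abs_mfps (\<lambda>m. \<Sum>i | i \<in> A \<and> mfps_nth (f i) m \<noteq> 0. mfps_nth (f i) m)) A"
    (is "(f has_sum ?S) A")
  unfolding has_sum_def
proof (rule topological_tendstoI)
  fix U :: "('v, 'a) mfps set"
  assume "open U" "?S \<in> U"
  then obtain M where M: "finite M" "{G. \<forall>m\<in>M. mfps_nth G m = mfps_nth ?S m} \<subseteq> U"
    unfolding open_mfps_def by meson
  let ?I = "\<Union>m\<in>M. {i\<in>A. mfps_nth (f i) m \<noteq> 0}"
  have "sum f X \<in> U" if X: "finite X" "?I \<subseteq> X" "X \<subseteq> A" for X
  proof -
    have "mfps_nth (sum f X) m = mfps_nth ?S m" if "m \<in> M" for m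
    proof -
      have "mfps_nth (sum f X) m = (\<Sum>i\<in>X. mfps_nth (f i) m)"
        by (rule mfps_nth_sum)
      also have "\<dots> = (\<Sum>i | i \<in> A \<and> mfps_nth (f i) m \<noteq> 0. mfps_nth (f i) m)"
        by (rule sum.mono_neutral_right) (use X \<open>m \<in> M\<close> in auto)
      finally show ?thesis by simp
    qed
    then show ?thesis using M by blast
  qed
  moreover have "finite ?I" using M fin by blast
  moreover have "?I \<subseteq> A" by blast
  ultimately show "\<forall>\<^sub>F X in finite_subsets_at_top A. sum f X \<in> U"
    unfolding eventually_finite_subsets_at_top by (intro exI[of _ ?I]) auto
qed

definition mfps_const :: "'a \<Rightarrow> ('v, 'a::comm_ring_1) mfps" where
  "mfps_const c = Abs_mfps (\<lambda>m. if m = 0 then c else 0)"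

definition mfps_var :: "'v \<Rightarrow> ('v, 'a::comm_ring_1) mfps" where
  "mfps_var v = Abs_mfps (\<lambda>m. if m = Poly_Mapping.single v 1 then 1 else 0)"

text \<open>Meaningful for series with constant term 0, where the sum is locally finite.\<close>

definition mfps_exp :: "('v, 'a::field_char_0) mfps \<Rightarrow> ('v, 'a) mfps" where
  "mfps_exp F = (\<Sum>\<^sub>\<infinity>i\<in>(UNIV :: nat set). mfps_const (1 / fact i) * F ^ i)"


section \<open>The hyperoctahedral group\<close>

definition signed_set :: "nat \<Rightarrow> int set" where
  "signed_set n = {- int n..int n} - {0}"

text \<open>
  Elements are extended by the identity outside \<open>{\<plusminus>1, \<dots>, \<plusminus>n}\<close>; the group operation is
  composition, with identity \<^term>\<open>id\<close>.
\<close>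

definition B_group :: "nat \<Rightarrow> (int \<Rightarrow> int) set" where
  "B_group n = {w. w permutes signed_set n \<and> (\<forall>i. w (- i) = - w i)}"

definition B_chi :: "nat \<Rightarrow> (int \<Rightarrow> int) \<Rightarrow> int" where
  "B_chi n w = (\<Prod>i\<in>{1..int n}. sgn (w i))"

definition B_sroots :: "nat \<Rightarrow> nat \<Rightarrow> (int \<Rightarrow> int) \<Rightarrow> int" where
  "B_sroots k n y = (\<Sum>x | x \<in> B_group n \<and> x ^^ k = y. B_chi n x)"

definition B_centralizer :: "nat \<Rightarrow> (int \<Rightarrow> int) \<Rightarrow> (int \<Rightarrow> int) set" where
  "B_centralizer n y = {x \<in> B_group n. x \<circ> y = y \<circ> x}"

text \<open>
  A cycle of \<open>w\<close> on \<open>{\<plusminus>1, \<dots>, \<plusminus>n}\<close> is represented by its set of entries, an orbit of \<open>w\<close>;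
  the negated cycle is then the image under negation.
  A cycle of class \<open>+1\<close> is an unordered pair \<open>{c, -c}\<close> of distinct orbits; its length is
  \<open>card c = card (c \<union> -c) div 2\<close>.
  A cycle of class \<open>-1\<close> is an orbit \<open>c = -c\<close>, with length \<open>card c div 2\<close>.
\<close>

definition orbits_on :: "nat \<Rightarrow> (int \<Rightarrow> int) \<Rightarrow> int set set" where
  "orbits_on n w = orbit w ` signed_set n"

definition pos_cycles :: "nat \<Rightarrow> (int \<Rightarrow> int) \<Rightarrow> int set set set" where
  "pos_cycles n w = {{c, uminus ` c} | c. c \<in> orbits_on n w \<and> c \<noteq> uminus ` c}"

definition neg_cycles :: "nat \<Rightarrow> (int \<Rightarrow> int) \<Rightarrow> int set set" where
  "neg_cycles n w = {c \<in> orbits_on n w. c = uminus ` c}"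

type_synonym bipartition = "nat multiset \<times> nat multiset"

definition bipartitions :: "nat \<Rightarrow> bipartition set" where
  "bipartitions n = {(p, q). 0 \<notin># p \<and> 0 \<notin># q \<and> sum_mset p + sum_mset q = n}"

definition B_cycle_type :: "nat \<Rightarrow> (int \<Rightarrow> int) \<Rightarrow> bipartition" where
  "B_cycle_type n w =
     (image_mset (\<lambda>C. card (\<Union>C) div 2) (mset_set (pos_cycles n w)),
      image_mset (\<lambda>c. card c div 2) (mset_set (neg_cycles n w)))"

text \<open>
  Quantities attached to a conjugacy class are evaluated at an arbitrarily chosen element of
  the class; every bipartition of \<open>n\<close> is the cycle type of some element, and elements of the same
  cycle type are conjugate.
\<close>

definition B_class_elem :: "nat \<Rightarrow> bipartition \<Rightarrow> int \<Rightarrow> int" where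
  "B_class_elem n \<mu> = (SOME y. y \<in> B_group n \<and> B_cycle_type n y = \<mu>)"

definition B_class_sroots :: "nat \<Rightarrow> nat \<Rightarrow> bipartition \<Rightarrow> int" where
  "B_class_sroots k n \<mu> = B_sroots k n (B_class_elem n \<mu>)"

definition B_class_centralizer_order :: "nat \<Rightarrow> bipartition \<Rightarrow> nat" where
  "B_class_centralizer_order n \<mu> = card (B_centralizer n (B_class_elem n \<mu>))"


section \<open>Indeterminates and signed root counts of \<open>\<int>\<^sub>2\<close>\<close>

definition Z2 :: "int set" where
  "Z2 = {1, -1}"

definition Z2_sroots :: "nat \<Rightarrow> int \<Rightarrow> int" where
  "Z2_sroots h \<theta> = (\<Sum>\<epsilon> | \<epsilon> \<in> Z2 \<and> \<epsilon> ^ h = \<theta>. \<epsilon>)"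

text \<open>
  The indeterminate \<open>t\<^sub>j\<^sub>,\<^sub>\<theta>\<close> has index \<open>(j, \<theta>)\<close>. Only those with \<open>j \<ge> 1\<close> and \<open>\<theta> \<in> {1, -1}\<close>
  occur; the remaining indices of type \<^typ>\<open>nat \<times> int\<close> are unused indeterminates.
\<close>

type_synonym tseries = "(nat \<times> int, complex) mfps"

definition tvar :: "nat \<Rightarrow> int \<Rightarrow> tseries" where
  "tvar j \<theta> = mfps_var (j, \<theta>)"

definition part_of_class :: "bipartition \<Rightarrow> int \<Rightarrow> nat multiset" where
  "part_of_class \<mu> \<theta> = (if \<theta> = 1 then fst \<mu> else snd \<mu>)"

text \<open>Factors with \<open>j\<close> not a part of \<open>\<mu>\<^sup>\<theta>\<close> have exponent 0 and are omitted.\<close>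

definition tmonom :: "bipartition \<Rightarrow> tseries" where
  "tmonom \<mu> = (\<Prod>\<theta>\<in>Z2. \<Prod>j\<in>set_mset (part_of_class \<mu> \<theta>).
     tvar j \<theta> ^ (j * count (part_of_class \<mu> \<theta>) j))"

end

theory Submission
  imports Defs
begin

text \<open>
  Orbit counting turns the degree \<open>n\<close> part of the left-hand side into the average over \<open>x \<in> B\<^sub>n\<close> of
  \<open>\<chi>(x) t\<^bsup>c(x^k)\<^esup>\<close>. The monomial is the product over \<open>i = 1, \<dots>, n\<close> of \<open>t\<^sub>j\<^sub>,\<^sub>\<theta>\<close>, where \<open>j\<close> and \<open>\<theta>\<close>
  are the length and class of the cycle of \<open>x^k\<close> through \<open>i\<close>; these depend only on the length \<open>l\<close> and
  class \<open>\<epsilon>\<close> of the cycle of \<open>x\<close> through \<open>i\<close>, namely \<open>j = l / gcd l k\<close> and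
  \<open>\<theta> = \<epsilon> ^ (k / gcd l k)\<close>. Splitting off the cycle of \<open>x\<close> through one fixed point gives
  \<open>n P\<^sub>n = \<Sum>\<^sub>l C\<^sub>l P\<^sub>n\<^sub>-\<^sub>l\<close> for these averages \<open>P\<^sub>n\<close>, where \<open>C\<^sub>l = (\<Sum>\<^sub>\<epsilon> \<epsilon> t\<^sub>j\<^sub>,\<^sub>\<theta>\<^sup>l) / 2\<close>. With the
  Euler operator \<open>D\<close> (multiplication of every coefficient by the degree of its monomial) this reads
  \<open>D G = D E \<cdot> G\<close> for the left-hand side \<open>G\<close> and the exponent \<open>E\<close>, which forces \<open>G = exp E\<close>.
\<close>

section \<open>The Euler operator and the exponential\<close>

text \<open>The class quantities on the left are values at a representative picked by choice, so
  orbit counting rests on two facts: every bipartition is realised, and equal cycle types are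
  conjugate. Both are proved by the same surgery as the recursion, taking off or putting in one
  cycle. What is left after a removal lives on a set closed under negation that need not be any
  \<open>signed_set m\<close>; hence the combinatorics is stated for arbitrary symmetric sets. Cycle
  types enter through the number of points of given length and class, because these counts are
  additive under the surgery. A cycle is encoded by a list, one turn up to sign, together with a
  closing sign, so that both classes are treated alike. On the analytic side there are infinitely
  many indeterminates. The Euler operator is a single derivation that sees all of them and, in
  characteristic 0, kills only constants; the recursion for the averages is graded by the same
  degree, so it is the differential equation read degree by degree.\<close>

definition mdeg :: "('v \<Rightarrow>\<^sub>0 nat) \<Rightarrow> nat" where
  "mdeg m = (\<Sum>v\<in>Poly_Mapping.keys m. Poly_Mapping.lookup m v)"

lemma mdeg_superset:
  assumes "finite A" "Poly_Mapping.keys m \<subseteq> A"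
  shows "mdeg m = (\<Sum>v\<in>A. Poly_Mapping.lookup m v)"
  unfolding mdeg_def
  by (rule sum.mono_neutral_left) (use assms in \<open>auto simp: in_keys_iff\<close>)

lemma mdeg_add: "mdeg (a + b) = mdeg a + mdeg b"
proof -
  let ?A = "Poly_Mapping.keys a \<union> Poly_Mapping.keys b"
  have "mdeg (a + b) = (\<Sum>v\<in>?A. Poly_Mapping.lookup (a + b) v)"
    using Poly_Mapping.keys_add[of a b] by (intro mdeg_superset) auto
  also have "\<dots> = mdeg a + mdeg b"
    by (simp add: lookup_add sum.distrib mdeg_superset[of ?A])
  finally show ?thesis .
qed

lemma mdeg_0 [simp]: "mdeg 0 = 0"
  by (simp add: mdeg_def)

lemma mdeg_eq_0_iff [simp]: "mdeg m = 0 \<longleftrightarrow> m = 0"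
proof
  assume "mdeg m = 0"
  then have "\<forall>v\<in>Poly_Mapping.keys m. Poly_Mapping.lookup m v = 0"
    by (simp add: mdeg_def)
  then show "m = 0"
    by (intro poly_mapping_eqI) (metis in_keys_iff lookup_zero)
qed simp

lemma mdeg_single [simp]: "mdeg (Poly_Mapping.single v n) = n"
  by (simp add: mdeg_def)

lemma mfps_nth_mult:
  "mfps_nth (F * G) m = (\<Sum>(a, b)\<in>splittings m. mfps_nth F a * mfps_nth G b)"
  by (simp add: times_mfps_def)

lemma mfps_nth_0 [simp]: "mfps_nth 0 m = 0"
  by (simp add: zero_mfps_def)

lemma mfps_nth_1: "mfps_nth 1 m = (if m = 0 then 1 else 0)"
  by (simp add: one_mfps_def)

lemma mfps_nth_const_mult [simp]:
  fixes F :: "('v, 'a::comm_ring_1) mfps"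
  shows "mfps_nth (mfps_const c * F) m = c * mfps_nth F m"
proof -
  have "mfps_nth (mfps_const c * F) m =
      (\<Sum>(a, b)\<in>splittings m. (if a = 0 then c else 0) * mfps_nth F b)"
    by (simp add: times_mfps_def mfps_const_def)
  also have "\<dots> = (\<Sum>(a, b)\<in>{(0 :: 'v \<Rightarrow>\<^sub>0 nat, m)}. (if a = 0 then c else 0) * mfps_nth F b)"
    by (rule sum.mono_neutral_right, simp) (auto simp: splittings_def split: if_splits)
  finally show ?thesis by simp
qed

lemma mfps_nth_const: "mfps_nth (mfps_const c) m = (if m = 0 then c else 0)"
  by (simp add: mfps_const_def)

lemma mfps_const_mult: "mfps_const (c * d) = mfps_const c * mfps_const d"
  by (rule mfps_eqI) (simp add: mfps_nth_const)

lemma mfps_const_of_nat: "mfps_const (of_nat n) = (of_nat n :: ('v, 'a::comm_ring_1) mfps)"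
proof (induction n)
  case 0
  show ?case by (rule mfps_eqI) (simp add: mfps_const_def)
next
  case (Suc n)
  have "mfps_const (of_nat (Suc n)) = (1 :: ('v, 'a) mfps) + mfps_const (of_nat n)"
    by (rule mfps_eqI) (simp add: mfps_nth_const mfps_nth_1 plus_mfps_def)
  with Suc.IH show ?case by (simp only: of_nat_Suc)
qed

lemma mfps_const_of_int: "mfps_const (of_int n) = (of_int n :: ('v, 'a::comm_ring_1) mfps)"
proof (cases n)
  case (nonneg k)
  then show ?thesis by (simp add: mfps_const_of_nat)
next
  case (neg k)
  have "mfps_const (of_int n) = (- mfps_const (of_nat (Suc k)) :: ('v, 'a) mfps)"
    unfolding neg by (rule mfps_eqI) (simp add: mfps_const_def uminus_mfps_def)
  then show ?thesis unfolding mfps_const_of_nat neg by simp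
qed

lemma mfps_nth_var_power:
  fixes v :: 'v
  shows "mfps_nth (mfps_var v ^ n :: ('v, 'a::comm_ring_1) mfps) m = (if m = Poly_Mapping.single v n then 1 else 0)"
proof (induction n arbitrary: m)
  case 0
  then show ?case by (simp add: one_mfps_def)
next
  case (Suc n)
  let ?s = "Poly_Mapping.single v (1::nat)" and ?t = "Poly_Mapping.single v n"
  have st: "?s + ?t = Poly_Mapping.single v (Suc n)"
    by (simp add: single_add[symmetric])
  have "mfps_nth (mfps_var v ^ Suc n :: ('v, 'a) mfps) m =
      (\<Sum>(a, b)\<in>splittings m. (if a = ?s then 1 else 0) * (if b = ?t then 1 else 0))"
    by (simp add: times_mfps_def Suc.IH) (simp add: mfps_var_def)
  also have "\<dots> = (\<Sum>(a, b)\<in>splittings m. if (a, b) = (?s, ?t) then 1 else 0)"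
    by (rule sum.cong) auto
  also have "\<dots> = (if (?s, ?t) \<in> splittings m then 1 else 0)"
    using sum.delta[of "splittings m" "(?s, ?t)" "\<lambda>_. 1"] by (simp add: case_prod_unfold prod_eq_iff)
  also have "(?s, ?t) \<in> splittings m \<longleftrightarrow> m = Poly_Mapping.single v (Suc n)"
    using st by (auto simp: splittings_def)
  finally show ?case .
qed

definition euler :: "('v, 'a::comm_ring_1) mfps \<Rightarrow> ('v, 'a) mfps" where
  "euler F = Abs_mfps (\<lambda>m. of_nat (mdeg m) * mfps_nth F m)"

lemma euler_nth [simp]: "mfps_nth (euler F) m = of_nat (mdeg m) * mfps_nth F m"
  by (simp add: euler_def)

lemma euler_mult: "euler (F * G) = euler F * G + F * euler G"
proof (rule mfps_eqI)
  fix m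
  have "mfps_nth (euler (F * G)) m =
      (\<Sum>(a, b)\<in>splittings m. of_nat (mdeg m) * (mfps_nth F a * mfps_nth G b))"
    by (simp add: mfps_nth_mult sum_distrib_left case_prod_unfold)
  also have "\<dots> = (\<Sum>(a, b)\<in>splittings m.
      of_nat (mdeg a) * mfps_nth F a * mfps_nth G b + mfps_nth F a * (of_nat (mdeg b) * mfps_nth G b))"
    by (rule sum.cong) (auto simp: splittings_def mdeg_add algebra_simps)
  also have "\<dots> = mfps_nth (euler F * G + F * euler G) m"
    by (simp add: plus_mfps_def mfps_nth_mult sum.distrib case_prod_unfold)
  finally show "mfps_nth (euler (F * G)) m = mfps_nth (euler F * G + F * euler G) m" .
qed

lemma euler_power: "euler (F ^ Suc i) = of_nat (Suc i) * (euler F * F ^ i)"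
proof (induction i)
  case 0
  show ?case by simp
next
  case (Suc i)
  have "euler (F ^ Suc (Suc i)) = euler F * F ^ Suc i + F * euler (F ^ Suc i)"
    by (subst power_Suc) (rule euler_mult)
  also have "\<dots> = of_nat (Suc (Suc i)) * (euler F * F ^ Suc i)"
    unfolding Suc.IH by (simp add: algebra_simps)
  finally show ?case .
qed

text \<open>Without a constant term every factor contributes degree at least 1. This is what makes
  the exponential sum locally finite.\<close>

lemma mfps_nth_power_eq_0:
  assumes "mfps_nth F 0 = 0" "mdeg m < i"
  shows "mfps_nth (F ^ i) m = 0"
  using assms(2)
proof (induction i arbitrary: m)
  case (Suc i)
  have "mfps_nth F a * mfps_nth (F ^ i) b = 0" if "(a, b) \<in> splittings m" for a b
  proof (cases "a = 0")
    case False
    then have "mdeg a > 0" using mdeg_eq_0_iff by blast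
    with that Suc.prems have "mdeg b < i" by (auto simp: splittings_def mdeg_add)
    then show ?thesis by (simp add: Suc.IH)
  qed (simp add: assms(1))
  then show ?case by (auto simp: mfps_nth_mult intro!: sum.neutral)
qed simp

text \<open>The cut-off \<open>N\<close> is left free so that one bound serves all monomials in the
  splittings of a given one, and so that it can be raised by one before an index shift.\<close>

lemma mfps_nth_exp:
  assumes "mfps_nth F 0 = 0" "mdeg m \<le> N"
  shows "mfps_nth (mfps_exp F) m = (\<Sum>i\<le>N. mfps_nth (F ^ i) m / fact i)"
proof -
  let ?f = "\<lambda>i. mfps_const (1 / fact i) * F ^ i"
  have sub: "{i. i \<in> UNIV \<and> mfps_nth (?f i) m \<noteq> 0} \<subseteq> {..mdeg m}" for m
    using mfps_nth_power_eq_0[OF assms(1)] by (auto simp: not_less[symmetric])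
  have "(?f has_sum Abs_mfps (\<lambda>m. \<Sum>i | i \<in> UNIV \<and> mfps_nth (?f i) m \<noteq> 0. mfps_nth (?f i) m)) UNIV"
    by (rule has_sum_mfps) (rule finite_subset[OF sub], simp)
  then have "mfps_nth (mfps_exp F) m =
      (\<Sum>i | i \<in> UNIV \<and> mfps_nth (?f i) m \<noteq> 0. mfps_nth (?f i) m)"
    unfolding mfps_exp_def by (simp add: infsumI)
  also have "\<dots> = (\<Sum>i\<le>N. mfps_nth (?f i) m)"
    by (rule sum.mono_neutral_left) (use sub[of m] assms(2) in force)+
  finally show ?thesis by simp
qed

lemma euler_exp:
  fixes F :: "('v, 'a::field_char_0) mfps"
  assumes F0: "mfps_nth F 0 = 0"
  shows "euler (mfps_exp F) = euler F * mfps_exp F"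
proof (rule mfps_eqI)
  fix m :: "'v \<Rightarrow>\<^sub>0 nat"
  let ?N = "mdeg m"
  have le: "mdeg b \<le> ?N" if "(a, b) \<in> splittings m" for a b :: "'v \<Rightarrow>\<^sub>0 nat"
    using that by (auto simp: splittings_def mdeg_add)
  have scale: "of_nat (mdeg m) * mfps_nth (F ^ Suc i) m = of_nat (Suc i) * mfps_nth (euler F * F ^ i) m" for i
  proof -
    have "mfps_nth (euler (F ^ Suc i)) m = mfps_nth (mfps_const (of_nat (Suc i)) * (euler F * F ^ i)) m"
      unfolding euler_power mfps_const_of_nat ..
    then show ?thesis by (simp only: euler_nth mfps_nth_const_mult)
  qed
  \<comment> \<open>The cut-off is \<open>Suc ?N\<close> because the term \<open>i = 0\<close> will
    be split off and the rest shifted down, leaving a sum up to \<open>?N\<close>.\<close>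
  have "mfps_nth (euler (mfps_exp F)) m
      = of_nat ?N * (\<Sum>i\<le>Suc ?N. mfps_nth (F ^ i) m / fact i)"
    by (simp add: mfps_nth_exp[OF F0, of m "Suc ?N"] del: sum.atMost_Suc power_Suc)
  also have "\<dots> = of_nat ?N * mfps_nth 1 m + (\<Sum>i\<le>?N. of_nat ?N * mfps_nth (F ^ Suc i) m / fact (Suc i))"
    by (subst sum.atMost_Suc_shift) (simp add: distrib_left sum_distrib_left)
  also have "of_nat ?N * mfps_nth 1 m = (0::'a)"
    by (simp add: mfps_nth_1)
  also have "0 + (\<Sum>i\<le>?N. of_nat ?N * mfps_nth (F ^ Suc i) m / fact (Suc i))
      = (\<Sum>i\<le>?N. mfps_nth (euler F * F ^ i) m / fact i)"
    unfolding scale by (simp add: field_simps del: of_nat_Suc)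
  also have "\<dots> = (\<Sum>i\<le>?N. \<Sum>(a, b)\<in>splittings m. mfps_nth (euler F) a * (mfps_nth (F ^ i) b / fact i))"
    by (simp add: mfps_nth_mult sum_divide_distrib case_prod_unfold)
  also have "\<dots> = (\<Sum>(a, b)\<in>splittings m. mfps_nth (euler F) a * (\<Sum>i\<le>?N. mfps_nth (F ^ i) b / fact i))"
    by (subst sum.swap) (simp add: sum_distrib_left case_prod_unfold)
  also have "\<dots> = (\<Sum>(a, b)\<in>splittings m. mfps_nth (euler F) a * mfps_nth (mfps_exp F) b)"
    by (rule sum.cong) (auto simp: mfps_nth_exp[OF F0 le])
  also have "\<dots> = mfps_nth (euler F * mfps_exp F) m"
    by (simp add: mfps_nth_mult)
  finally show "mfps_nth (euler (mfps_exp F)) m = mfps_nth (euler F * mfps_exp F) m" .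
qed

text \<open>The differential equation determines the coefficients by recursion on the degree.\<close>

lemma mfps_exp_unique:
  fixes F G :: "('v, 'a::field_char_0) mfps"
  assumes F0: "mfps_nth F 0 = 0" and G0: "mfps_nth G 0 = 1"
    and G: "euler G = euler F * G"
  shows "G = mfps_exp F"
proof (rule mfps_eqI)
  fix m
  show "mfps_nth G m = mfps_nth (mfps_exp F) m"
  proof (induction "mdeg m" arbitrary: m rule: less_induct)
    case less
    show ?case
    proof (cases "m = 0")
      case True
      then show ?thesis using mfps_nth_exp[OF F0, of 0 0] G0 by (simp add: mfps_nth_1)
    next
      case False
      \<comment> \<open>The summand with \<open>a = 0\<close> vanishes because the Euler operator
        kills constant terms; every other one involves \<open>b\<close> of smaller degree, where the
        induction hypothesis applies.\<close>
      have "mfps_nth (euler F) a * mfps_nth G b = mfps_nth (euler F) a * mfps_nth (mfps_exp F) b"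
        if "(a, b) \<in> splittings m" for a b
      proof (cases "a = 0")
        case False
        then have "mdeg a > 0" using mdeg_eq_0_iff by blast
        with that have "mdeg b < mdeg m" by (auto simp: splittings_def mdeg_add)
        then show ?thesis using less by simp
      qed simp
      then have "mfps_nth (euler F * G) m = mfps_nth (euler F * mfps_exp F) m"
        unfolding mfps_nth_mult by (intro sum.cong) auto
      then have "of_nat (mdeg m) * mfps_nth G m = of_nat (mdeg m) * mfps_nth (mfps_exp F) m"
        using arg_cong[OF G, of "\<lambda>H. mfps_nth H m"] arg_cong[OF euler_exp[OF F0], of "\<lambda>H. mfps_nth H m"]
        by simp
      with False show ?thesis by simp
    qed
  qed
qed

section \<open>Cycle length and class at a point\<close>

text \<open>The shape that survives the removal of a cycle. Excluding 0 guarantees that x and -x are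
  distinct.\<close>

definition sym_set :: "int set \<Rightarrow> bool" where
  "sym_set S \<longleftrightarrow> finite S \<and> 0 \<notin> S \<and> (\<forall>x\<in>S. - x \<in> S)"

definition signed_perms :: "int set \<Rightarrow> (int \<Rightarrow> int) set" where
  "signed_perms S = {w. w permutes S \<and> (\<forall>i. w (- i) = - w i)}"

lemma B_group_eq: "B_group n = signed_perms (signed_set n)"
  by (simp add: B_group_def signed_perms_def)

lemma sym_set_signed_set [simp]: "sym_set (signed_set n)"
  by (auto simp: sym_set_def signed_set_def)

text \<open>
  Cycle types are read off pointwise: the cycle through \<open>x\<close> first returns to \<open>{x, -x}\<close> after a number
  of steps equal to its length, and its class is the sign picked up.
\<close>

definition blen :: "(int \<Rightarrow> int) \<Rightarrow> int \<Rightarrow> nat" where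
  "blen w x = (LEAST l. 0 < l \<and> (w ^^ l) x \<in> {x, - x})"

definition bcl :: "(int \<Rightarrow> int) \<Rightarrow> int \<Rightarrow> int" where
  "bcl w x = (if (w ^^ blen w x) x = x then 1 else -1)"

text \<open>The orbit has \<open>blen w x\<close> or \<open>2 * blen w x\<close> points according to
  the class; joining it with its negative gives \<open>2 * blen w x\<close> in both cases.\<close>

definition block :: "(int \<Rightarrow> int) \<Rightarrow> int \<Rightarrow> int set" where
  "block w x = orbit w x \<union> uminus ` orbit w x"

lemma bcl_Z2: "bcl w x \<in> Z2"
  by (simp add: bcl_def Z2_def)

lemma bcl_cases: "bcl w x = 1 \<or> bcl w x = -1"
  by (simp add: bcl_def)

text \<open>Length and class depend only on the trajectory of the point, so changing a permutation
  away from that trajectory is harmless.\<close>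

lemma blen_bcl_cong:
  assumes "\<And>t. (w ^^ t) x = (w' ^^ t) x"
  shows "blen w x = blen w' x" "bcl w x = bcl w' x"
  using assms by (simp_all add: blen_def bcl_def)

lemma finite_signed_perms: "finite S \<Longrightarrow> finite (signed_perms S)"
  by (rule finite_subset[OF _ finite_permutations[of S]]) (auto simp: signed_perms_def)

lemma signed_perms_comp:
  "u \<in> signed_perms S \<Longrightarrow> v \<in> signed_perms S \<Longrightarrow> u \<circ> v \<in> signed_perms S"
  by (auto simp: signed_perms_def intro: permutes_compose)

lemma signed_perms_id: "id \<in> signed_perms S"
  by (simp add: signed_perms_def permutes_id)

lemma signed_perms_funpow: "u \<in> signed_perms S \<Longrightarrow> u ^^ k \<in> signed_perms S"
  by (induction k) (auto intro: signed_perms_comp signed_perms_id)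

lemma signed_perms_inv:
  assumes "u \<in> signed_perms S"
  shows "inv u \<in> signed_perms S"
proof -
  have u: "u permutes S" "\<And>i. u (- i) = - u i"
    using assms by (auto simp: signed_perms_def)
  have "inv u (- i) = - inv u i" for i
    by (subst permutes_inverses(2)[OF u(1), symmetric, of "- inv u i"])
      (simp add: u(2) permutes_inverses[OF u(1)])
  then show ?thesis using u(1) by (simp add: signed_perms_def permutes_inv)
qed

locale signed_perm =
  fixes S :: "int set" and w :: "int \<Rightarrow> int"
  assumes sym: "sym_set S" and w_in: "w \<in> signed_perms S"
begin

lemma fin: "finite S" and zero_notin: "0 \<notin> S"
  using sym by (auto simp: sym_set_def)

lemma minus_in: "- x \<in> S \<longleftrightarrow> x \<in> S"
  using sym unfolding sym_set_def by (metis minus_minus)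

lemma w_permutes: "w permutes S"
  using w_in by (simp add: signed_perms_def)

lemma funpow_permutes: "(w ^^ t) permutes S"
  using signed_perms_funpow[OF w_in] by (simp add: signed_perms_def)

lemma funpow_minus [simp]: "(w ^^ t) (- x) = - (w ^^ t) x"
  using signed_perms_funpow[OF w_in] by (simp add: signed_perms_def)

lemma funpow_in [simp]: "(w ^^ t) x \<in> S \<longleftrightarrow> x \<in> S"
  using funpow_permutes permutes_in_image by metis

lemma funpow_inj: "(w ^^ t) x = (w ^^ t) y \<longleftrightarrow> x = y"
  using funpow_permutes permutes_inj by (metis injD)

lemma self_in_orbit: "x \<in> orbit w x"
  using permutation_self_in_orbit[of w x] permutation_permutes w_permutes fin by blast

lemma orbit_eq: "orbit w x = {(w ^^ t) x | t. True}"
  using self_in_orbit by (rule orbit_altdef_self_in)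

lemma blen_props: "0 < blen w x \<and> (w ^^ blen w x) x \<in> {x, - x}"
proof -
  obtain t where "0 < t" "(w ^^ t) x = x"
    using self_in_orbit[of x] unfolding orbit_altdef by auto
  then have "\<exists>l. 0 < l \<and> (w ^^ l) x \<in> {x, - x}" by auto
  then show ?thesis unfolding blen_def by (rule LeastI_ex)
qed

lemma blen_pos [simp]: "0 < blen w x"
  using blen_props by blast

lemma blen_least: "0 < t \<Longrightarrow> (w ^^ t) x \<in> {x, - x} \<Longrightarrow> blen w x \<le> t"
  unfolding blen_def by (rule Least_le) simp

lemma funpow_blen: "(w ^^ blen w x) x = bcl w x * x"
  using blen_props[of x] by (auto simp: bcl_def)

lemma funpow_sign_mult: "c \<in> Z2 \<Longrightarrow> (w ^^ t) (c * x) = c * (w ^^ t) x"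
  by (auto simp: Z2_def)

lemma Z2_power: "c \<in> Z2 \<Longrightarrow> c ^ q \<in> Z2"
  by (induction q) (auto simp: Z2_def)

lemma funpow_blen_mult: "(w ^^ (q * blen w x)) x = bcl w x ^ q * x"
proof (induction q)
  case (Suc q)
  have "(w ^^ (Suc q * blen w x)) x = (w ^^ blen w x) ((w ^^ (q * blen w x)) x)"
    by (simp add: funpow_add)
  also have "\<dots> = bcl w x ^ Suc q * x"
    by (simp add: Suc.IH funpow_sign_mult Z2_power bcl_Z2 funpow_blen)
  finally show ?case .
qed simp

text \<open>Full turns only change the sign, so if t is a return time up to sign then so is its
  remainder modulo the length, and minimality forces the remainder to be 0.\<close>

lemma funpow_pm_iff: "(w ^^ t) x \<in> {x, - x} \<longleftrightarrow> blen w x dvd t"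
proof
  assume t: "(w ^^ t) x \<in> {x, - x}"
  let ?l = "blen w x"
  have "(w ^^ t) x = (w ^^ (t mod ?l)) ((w ^^ (t div ?l * ?l)) x)"
    by (metis comp_apply funpow_add mod_div_mult_eq)
  also have "\<dots> = bcl w x ^ (t div ?l) * (w ^^ (t mod ?l)) x"
    by (simp add: funpow_blen_mult funpow_sign_mult Z2_power bcl_Z2)
  finally have "(w ^^ t) x = bcl w x ^ (t div ?l) * (w ^^ (t mod ?l)) x" .
  moreover have "bcl w x ^ (t div ?l) = 1 \<or> bcl w x ^ (t div ?l) = -1"
    using Z2_power[OF bcl_Z2, of w x "t div ?l"] by (simp add: Z2_def)
  ultimately have "(w ^^ (t mod ?l)) x \<in> {x, - x}"
    using t by auto
  then have "t mod ?l = 0"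
    using blen_least[of "t mod ?l" x] mod_less_divisor[OF blen_pos, of t x] by linarith
  then show "?l dvd t" by auto
next
  assume "blen w x dvd t"
  then obtain q where "t = q * blen w x" by (metis dvd_def mult.commute)
  then show "(w ^^ t) x \<in> {x, - x}"
    using Z2_power[OF bcl_Z2, of w x q] by (auto simp: funpow_blen_mult Z2_def)
qed

text \<open>A positive number is determined by the set of its multiples; lengths can thus be found
  by describing return times, without another minimality argument.\<close>

lemma blenI:
  assumes "\<And>t. (w ^^ t) x \<in> {x, - x} \<longleftrightarrow> d dvd t" "0 < d"
  shows "blen w x = d"
  using assms funpow_pm_iff by (meson dvd_antisym dvd_refl)

lemma bcl_eqI:
  assumes "x \<in> S" "(w ^^ blen w x) x = c * x"
  shows "bcl w x = c"
  using assms zero_notin by (simp add: funpow_blen) metis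

lemma funpow_abs_inj:
  assumes "s < blen w x" "t < blen w x" "\<bar>(w ^^ s) x\<bar> = \<bar>(w ^^ t) x\<bar>"
  shows "s = t"
proof -
  have *: "s = t" if "s \<le> t" "t < blen w x" "\<bar>(w ^^ s) x\<bar> = \<bar>(w ^^ t) x\<bar>" for s t
  proof -
    have "(w ^^ s) ((w ^^ (t - s)) x) = (w ^^ t) x"
      using that(1) by (metis comp_apply funpow_add le_add_diff_inverse)
    then have "(w ^^ s) ((w ^^ (t - s)) x) \<in> {(w ^^ s) x, (w ^^ s) (- x)}"
      using that(3) by auto
    then have "(w ^^ (t - s)) x \<in> {x, - x}"
      unfolding insert_iff empty_iff funpow_inj by simp
    then have "blen w x dvd t - s" by (simp only: funpow_pm_iff)
    with that show ?thesis using nat_dvd_not_less[of "t - s" "blen w x"] by linarith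
  qed
  show ?thesis
    using *[of s t] *[of t s] assms by (cases "s \<le> t") auto
qed

text \<open>With l the length, g = gcd l k: the return times t of the power satisfy l | k t, that is
  l/g | t by coprimality of l/g and k/g. At t = l/g the original permutation has made k/g full
  turns, each contributing one factor \<open>bcl w x\<close>.\<close>

lemma blen_funpow: "blen (w ^^ k) x = blen w x div gcd (blen w x) k"
  and bcl_funpow: "x \<in> S \<Longrightarrow> bcl (w ^^ k) x = bcl w x ^ (k div gcd (blen w x) k)"
proof -
  interpret wk: signed_perm S "w ^^ k"
    by unfold_locales (auto intro: sym signed_perms_funpow w_in)
  let ?l = "blen w x" and ?g = "gcd (blen w x) k"
  have g: "?l = ?g * (?l div ?g)" "k = ?g * (k div ?g)" "0 < ?g" by auto
  have pow: "((w ^^ k) ^^ t) x = (w ^^ (k * t)) x" for t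
    by (metis funpow_mult)
  have dvd: "?l dvd k * t \<longleftrightarrow> ?l div ?g dvd t" for t
  proof -
    have "?l dvd k * t \<longleftrightarrow> ?g * (?l div ?g) dvd ?g * (k div ?g * t)"
      using g by (metis mult.assoc)
    also have "\<dots> \<longleftrightarrow> ?l div ?g dvd k div ?g * t"
      using g(3) by (rule nat_mult_dvd_cancel1)
    also have "\<dots> \<longleftrightarrow> ?l div ?g dvd t"
      using div_gcd_coprime[of ?l k] coprime_dvd_mult_right_iff by (metis blen_pos less_irrefl)
    finally show ?thesis .
  qed
  show b: "blen (w ^^ k) x = ?l div ?g"
    by (rule wk.blenI, unfold pow funpow_pm_iff dvd) (simp_all add: div_greater_zero_iff dvd_imp_le)
  show "bcl (w ^^ k) x = bcl w x ^ (k div ?g)" if "x \<in> S"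
  proof (rule wk.bcl_eqI[OF that])
    have "k * (?l div ?g) = k div ?g * ?l"
      by (metis dvd_div_mult gcd_dvd1 gcd_dvd2 div_mult_swap mult.commute)
    then show "((w ^^ k) ^^ blen (w ^^ k) x) x = bcl w x ^ (k div ?g) * x"
      by (simp only: b pow funpow_blen_mult)
  qed
qed

lemma mem_block_iff: "y \<in> block w x \<longleftrightarrow> (\<exists>t. y = (w ^^ t) x \<or> y = - (w ^^ t) x)"
  by (auto simp: block_def orbit_eq)

lemma funpow_mod: "\<bar>(w ^^ t) x\<bar> = \<bar>(w ^^ (t mod blen w x)) x\<bar>"
proof -
  let ?l = "blen w x"
  have "(w ^^ t) x = (w ^^ (t mod ?l)) ((w ^^ (t div ?l * ?l)) x)"
    by (metis comp_apply funpow_add mod_div_mult_eq)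
  also have "\<dots> = bcl w x ^ (t div ?l) * (w ^^ (t mod ?l)) x"
    by (simp add: funpow_blen_mult funpow_sign_mult Z2_power bcl_Z2)
  finally show ?thesis
    using Z2_power[OF bcl_Z2, of w x "t div ?l"] by (auto simp: Z2_def)
qed

lemma block_eq_abs: "block w x = {y. \<exists>t<blen w x. \<bar>y\<bar> = \<bar>(w ^^ t) x\<bar>}"
proof (intro set_eqI iffI)
  fix y assume "y \<in> block w x"
  then obtain t where "\<bar>y\<bar> = \<bar>(w ^^ t) x\<bar>" unfolding mem_block_iff by auto
  then show "y \<in> {y. \<exists>t<blen w x. \<bar>y\<bar> = \<bar>(w ^^ t) x\<bar>}"
    using funpow_mod[of t x] mod_less_divisor[OF blen_pos, of t x] by (metis (mono_tags) mem_Collect_eq)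
qed (auto simp: mem_block_iff abs_eq_iff)

lemma block_subset: "x \<in> S \<Longrightarrow> block w x \<subseteq> S"
  by (auto simp: mem_block_iff minus_in)

lemma self_in_block: "x \<in> block w x"
  by (auto simp: mem_block_iff intro: exI[of _ 0])

lemma funpow_return: "\<exists>s. (w ^^ s) ((w ^^ t) x) = x"
  using orbit_swap[OF self_in_orbit, of "(w ^^ t) x" x] unfolding orbit_eq by auto metis

text \<open>Powers of \<open>w\<close> commute with \<open>w\<close> and with negation, so moving
  along the cycle or changing the sign of the point alters neither the return times nor the sign
  picked up.\<close>

lemma block_mem:
  assumes "y \<in> block w x"
  shows "orbit w y = orbit w x \<or> orbit w y = uminus ` orbit w x"
    and "block w y = block w x" and "blen w y = blen w x" and "x \<in> S \<Longrightarrow> bcl w y = bcl w x"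
proof -
  have orb_pow: "orbit w ((w ^^ t) x) = orbit w x" for t x
  proof
    show "orbit w ((w ^^ t) x) \<subseteq> orbit w x"
      by (auto simp: orbit_eq) (metis comp_apply funpow_add)
    obtain s where "(w ^^ s) ((w ^^ t) x) = x" using funpow_return by blast
    then show "orbit w x \<subseteq> orbit w ((w ^^ t) x)"
      by (auto simp: orbit_eq) (metis comp_apply funpow_add)
  qed
  have orb_neg: "orbit w (- x) = uminus ` orbit w x" for x
    by (auto simp: orbit_eq)
  obtain t where t: "y = (w ^^ t) x \<or> y = - (w ^^ t) x"
    using assms mem_block_iff by blast
  then show orb: "orbit w y = orbit w x \<or> orbit w y = uminus ` orbit w x"
    using orb_pow orb_neg by metis
  then show "block w y = block w x"
    by (auto simp: block_def image_image)
  have comm: "(w ^^ s) ((w ^^ t) x) = (w ^^ t) ((w ^^ s) x)" for s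
    by (metis add.commute comp_apply funpow_add)
  have "(w ^^ s) y \<in> {y, - y} \<longleftrightarrow> blen w x dvd s" for s
  proof -
    have "(w ^^ s) y \<in> {y, - y} \<longleftrightarrow> (w ^^ t) ((w ^^ s) x) \<in> {(w ^^ t) x, (w ^^ t) (- x)}"
      using t comm by auto
    also have "\<dots> \<longleftrightarrow> (w ^^ s) x \<in> {x, - x}"
      unfolding insert_iff empty_iff funpow_inj by simp
    finally show ?thesis by (simp only: funpow_pm_iff)
  qed
  then show b: "blen w y = blen w x"
    by (rule blenI) simp
  show "bcl w y = bcl w x" if x: "x \<in> S"
  proof (rule bcl_eqI)
    show "y \<in> S" using block_subset[OF x] assms by auto
    show "(w ^^ blen w y) y = bcl w x * y"
      using t comm[of "blen w x"] by (auto simp: b funpow_blen funpow_sign_mult bcl_Z2)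
  qed
qed

text \<open>Before the first return up to sign the absolute values along the trajectory are
  distinct, and each of them stands for two points.\<close>

lemma card_block:
  assumes "x \<in> S"
  shows "card (block w x) = 2 * blen w x"
proof -
  let ?P = "\<lambda>t. {(w ^^ t) x, - (w ^^ t) x}"
  have "block w x = (\<Union>t<blen w x. ?P t)"
    by (auto simp: block_eq_abs abs_eq_iff)
  also have "card \<dots> = (\<Sum>t<blen w x. card (?P t))"
    by (rule card_UN_disjoint) (use funpow_abs_inj[of _ x] in \<open>fastforce simp: abs_eq_iff\<close>)+
  also have "\<dots> = (\<Sum>t<blen w x. 2)"
  proof (rule sum.cong)
    fix t
    have "(w ^^ t) x \<noteq> 0" using assms funpow_in zero_notin by metis
    then show "card (?P t) = 2" by simp
  qed simp
  finally show ?thesis by simp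
qed

text \<open>This ties the class defined by a sign to the class defined by orbits. If -x is reached
  at time t, then t consists of q full turns and \<open>bcl w x ^ q = -1\<close>; conversely, if the
  sign is -1, one more turn negates any point of the orbit.\<close>

lemma orbit_neg_iff:
  assumes "x \<in> S"
  shows "orbit w x = uminus ` orbit w x \<longleftrightarrow> bcl w x = -1"
proof
  assume "orbit w x = uminus ` orbit w x"
  then have "- x \<in> orbit w x" using self_in_orbit by blast
  then obtain t where t: "(w ^^ t) x = - x" unfolding orbit_eq by auto
  then obtain q where "t = q * blen w x"
    using funpow_pm_iff[of t x] by (metis dvd_def insertCI mult.commute)
  with t have "bcl w x ^ q * x = - x" by (simp add: funpow_blen_mult)
  then show "bcl w x = -1"
    using assms zero_notin bcl_cases[of w x] by force
next
  assume "bcl w x = -1"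
  then have x: "(w ^^ blen w x) x = - x" by (simp add: funpow_blen)
  have "- (w ^^ t) x = (w ^^ (t + blen w x)) x" for t
    by (simp add: funpow_add x)
  then have sub: "uminus ` orbit w x \<subseteq> orbit w x"
    unfolding orbit_eq by blast
  then have "uminus ` uminus ` orbit w x \<subseteq> uminus ` orbit w x" by (rule image_mono)
  with sub show "orbit w x = uminus ` orbit w x" by (simp add: image_image)
qed

text \<open>The blocks partition the points of given length and class into pieces of size 2 j.
  Numbers of cycles can therefore be traded for numbers of points.\<close>

lemma card_class_points:
  "card {x \<in> S. blen w x = j \<and> bcl w x = \<theta>}
    = 2 * j * card {C \<in> block w ` {x \<in> S. bcl w x = \<theta>}. card C div 2 = j}"
proof -
  let ?X = "{x \<in> S. blen w x = j \<and> bcl w x = \<theta>}"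
  have blocks: "{C \<in> block w ` {x \<in> S. bcl w x = \<theta>}. card C div 2 = j} = block w ` ?X"
    by (auto simp: card_block)
  have un: "\<Union> (block w ` ?X) = ?X"
    using self_in_block block_subset block_mem(3,4) by fastforce
  have "(2 * j) * card (block w ` ?X) = card (\<Union> (block w ` ?X))"
  proof (rule card_partition)
    show "finite (block w ` ?X)" "finite (\<Union> (block w ` ?X))"
      unfolding un using fin by auto
    show "card c = 2 * j" if "c \<in> block w ` ?X" for c
      using that card_block by auto
    show "c1 \<inter> c2 = {}" if "c1 \<in> block w ` ?X" "c2 \<in> block w ` ?X" "c1 \<noteq> c2" for c1 c2
      using that block_mem(2) by blast
  qed
  then show ?thesis unfolding un blocks by simp
qed

end

section \<open>Cycle types expressed by counting points\<close>

definition pos_part :: "int set \<Rightarrow> int set" where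
  "pos_part S = {x \<in> S. 0 < x}"

lemma pos_part_signed_set: "pos_part (signed_set n) = {1..int n}"
  by (auto simp: pos_part_def signed_set_def)

lemma card_sym_set:
  assumes "sym_set S" "\<And>x. P (- x) = P x"
  shows "card {x \<in> S. P x} = 2 * card {x \<in> pos_part S. P x}"
proof -
  have S: "finite S" "0 \<notin> S" "\<And>x. - x \<in> S \<longleftrightarrow> x \<in> S"
    using assms(1) unfolding sym_set_def by (metis minus_minus)+
  let ?Q = "{x \<in> pos_part S. P x}"
  have "{x \<in> S. P x} = ?Q \<union> uminus ` ?Q"
  proof (intro set_eqI iffI)
    fix x assume x: "x \<in> {x \<in> S. P x}"
    then have "x \<noteq> 0" using S by auto
    then consider "0 < x" | "0 < - x" by linarith
    then show "x \<in> ?Q \<union> uminus ` ?Q"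
    proof cases
      case 2
      then have "- x \<in> ?Q" using x S assms(2) by (auto simp: pos_part_def)
      then show ?thesis by (metis UnI2 image_eqI minus_minus)
    qed (use x in \<open>auto simp: pos_part_def\<close>)
  qed (use S assms(2) in \<open>auto simp: pos_part_def\<close>)
  moreover have "card (?Q \<union> uminus ` ?Q) = card ?Q + card (uminus ` ?Q)"
    by (rule card_Un_disjoint) (use S(1) in \<open>auto simp: pos_part_def\<close>)
  ultimately show ?thesis by (simp add: card_image inj_on_def)
qed

text \<open>A cycle of class -1 is its own block, and taking the union of {c, -c} is injective on
  cycles of class +1, because a block determines its orbits up to negation. Both halves of the cycle
  type are thus multisets of half block sizes.\<close>

lemma part_of_class_cycle_type:
  assumes w: "w \<in> B_group n" and \<theta>: "\<theta> \<in> Z2"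
  shows "part_of_class (B_cycle_type n w) \<theta>
    = image_mset (\<lambda>C. card C div 2) (mset_set (block w ` {x \<in> signed_set n. bcl w x = \<theta>}))"
proof -
  interpret signed_perm "signed_set n" w
    by unfold_locales (use w in \<open>auto simp: B_group_eq\<close>)
  let ?S = "signed_set n"
  consider "\<theta> = 1" | "\<theta> = -1" using \<theta> by (auto simp: Z2_def)
  then show ?thesis
  proof cases
    case 1
    let ?f = "\<lambda>x. {orbit w x, uminus ` orbit w x}"
    have eq: "pos_cycles n w = ?f ` {x \<in> ?S. bcl w x = 1}"
      using orbit_neg_iff bcl_cases[of w]
      by (fastforce simp: pos_cycles_def orbits_on_def)
    have un: "\<Union> (?f x) = block w x" for x by (simp add: block_def)
    have feq: "?f x = ?f y" if "block w x = block w y" for x y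
    proof -
      have "y \<in> block w x" using that self_in_block by simp
      then show ?thesis using block_mem(1)[of y x] by (auto simp: image_image)
    qed
    have "inj_on Union (pos_cycles n w)"
      unfolding eq using feq un by (intro inj_onI) (metis (no_types, lifting) imageE)
    then have "image_mset Union (mset_set (pos_cycles n w)) = mset_set (Union ` pos_cycles n w)"
      by (rule image_mset_mset_set)
    moreover have "Union ` pos_cycles n w = block w ` {x \<in> ?S. bcl w x = 1}"
      unfolding eq image_image un ..
    ultimately have "image_mset (\<lambda>C. card C div 2) (image_mset Union (mset_set (pos_cycles n w)))
      = image_mset (\<lambda>C. card C div 2) (mset_set (block w ` {x \<in> ?S. bcl w x = 1}))"
      by simp
    then show ?thesis
      using 1 by (simp add: part_of_class_def B_cycle_type_def image_mset.compositionality comp_def)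
  next
    case 2
    have "neg_cycles n w = block w ` {x \<in> ?S. bcl w x = -1}"
    proof -
      have "neg_cycles n w = orbit w ` {x \<in> ?S. bcl w x = -1}"
        using orbit_neg_iff by (auto simp: neg_cycles_def orbits_on_def)
      also have "\<dots> = block w ` {x \<in> ?S. bcl w x = -1}"
        using orbit_neg_iff by (intro image_cong) (auto simp: block_def)
      finally show ?thesis .
    qed
    then show ?thesis using 2 by (simp add: part_of_class_def B_cycle_type_def)
  qed
qed

text \<open>Negation preserves length and class, so exactly half of the points are positive. The
  result is the exponent of \<open>tvar j \<theta>\<close> in \<open>tmonom\<close>.\<close>

lemma card_pos_class_points:
  assumes w: "w \<in> B_group n" and \<theta>: "\<theta> \<in> Z2"
  shows "card {i \<in> {1..int n}. blen w i = j \<and> bcl w i = \<theta>}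
    = j * count (part_of_class (B_cycle_type n w) \<theta>) j"
proof -
  interpret signed_perm "signed_set n" w
    by unfold_locales (use w in \<open>auto simp: B_group_eq\<close>)
  have "- x \<in> block w x" for x
    by (auto simp: mem_block_iff intro: exI[of _ 0])
  note even = block_mem(3,4)[OF this]
  let ?P = "\<lambda>x. blen w x = j \<and> x \<in> signed_set n \<and> bcl w x = \<theta>"
  have "{i \<in> {1..int n}. blen w i = j \<and> bcl w i = \<theta>} = {i \<in> pos_part (signed_set n). ?P i}"
    by (auto simp: pos_part_def signed_set_def)
  moreover have "card {i \<in> signed_set n. ?P i} = 2 * card {i \<in> pos_part (signed_set n). ?P i}"
    by (rule card_sym_set) (use even minus_in in auto)
  moreover have "card {i \<in> signed_set n. ?P i} = 2 * j * count (part_of_class (B_cycle_type n w) \<theta>) j"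
    using card_class_points[of j \<theta>] fin
    by (simp add: part_of_class_cycle_type[OF w \<theta>] count_image_mset_eq_card_vimage conj_ac)
  ultimately show ?thesis by simp
qed

section \<open>Splitting off the cycle through a point\<close>

text \<open>Such a list records one turn of a cycle, up to the first return up to sign. It serves
  for both classes, the closing sign being kept separately.\<close>

definition abs_distinct :: "int list \<Rightarrow> bool" where
  "abs_distinct L \<longleftrightarrow> 0 \<notin> set L \<and> distinct (map abs L)"

definition pm_set :: "int list \<Rightarrow> int set" where
  "pm_set L = {x. \<exists>t<length L. \<bar>x\<bar> = \<bar>L ! t\<bar>}"

text \<open>The odd map sending \<open>L ! t\<close> to \<open>M ! t\<close>, extended by the identity.\<close>

definition list_map :: "int list \<Rightarrow> int list \<Rightarrow> int \<Rightarrow> int" where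
  "list_map L M x = (if x \<in> pm_set L
     then (let t = LEAST t. t < length L \<and> \<bar>x\<bar> = \<bar>L ! t\<bar> in sgn x * sgn (L ! t) * M ! t) else x)"

lemma abs_distinct_nth_eq:
  "abs_distinct L \<Longrightarrow> s < length L \<Longrightarrow> t < length L \<Longrightarrow> \<bar>L ! s\<bar> = \<bar>L ! t\<bar> \<Longrightarrow> s = t"
  unfolding abs_distinct_def by (metis distinct_conv_nth length_map nth_map)

lemma abs_distinct_nth_nonzero: "abs_distinct L \<Longrightarrow> t < length L \<Longrightarrow> L ! t \<noteq> 0"
  unfolding abs_distinct_def by (metis nth_mem)

lemma pm_set_cases:
  assumes "x \<in> pm_set L"
  obtains t where "t < length L" "x = L ! t \<or> x = - (L ! t)"
  using assms by (auto simp: pm_set_def abs_eq_iff)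

lemma nth_in_pm_set: "t < length L \<Longrightarrow> L ! t \<in> pm_set L"
  by (auto simp: pm_set_def)

lemma minus_in_pm_set [simp]: "- x \<in> pm_set L \<longleftrightarrow> x \<in> pm_set L"
  by (simp add: pm_set_def)

lemma pm_set_eq: "pm_set L = set L \<union> uminus ` set L"
  by (auto simp: pm_set_def in_set_conv_nth abs_eq_iff image_iff)

lemma sym_set_pm_set: "abs_distinct L \<Longrightarrow> sym_set (pm_set L)"
  unfolding sym_set_def minus_in_pm_set by (auto simp: pm_set_eq abs_distinct_def)

lemma list_map_minus: "list_map L M (- x) = - list_map L M x"
  by (simp add: list_map_def Let_def)

lemma list_map_nth:
  assumes "abs_distinct L" "t < length L"
  shows "list_map L M (L ! t) = M ! t"
proof -
  have "(LEAST s. s < length L \<and> \<bar>L ! t\<bar> = \<bar>L ! s\<bar>) = t"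
    using abs_distinct_nth_eq[OF assms(1)] assms(2) by (intro Least_equality) auto
  then show ?thesis
    using nth_in_pm_set[OF assms(2)] abs_distinct_nth_nonzero[OF assms]
    by (simp add: list_map_def sgn_mult_self_eq)
qed

lemma list_map_outside: "x \<notin> pm_set L \<Longrightarrow> list_map L M x = x"
  by (simp add: list_map_def)

lemma list_map_inverse:
  assumes "abs_distinct L" "abs_distinct M" "length L = length M" "x \<in> pm_set L"
  shows "list_map L M x \<in> pm_set M \<and> list_map M L (list_map L M x) = x"
proof -
  obtain t where t: "t < length L" "x = L ! t \<or> x = - (L ! t)"
    using assms(4) by (rule pm_set_cases)
  then show ?thesis
    using assms list_map_nth[of L t M] list_map_nth[of M t L] nth_in_pm_set[of t M]
    by (auto simp: list_map_minus)
qed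

lemma list_map_bij_betw:
  assumes "abs_distinct L" "abs_distinct M" "length L = length M"
  shows "bij_betw (list_map L M) (pm_set L) (pm_set M)"
  by (rule bij_betw_byWitness[where f' = "list_map M L"])
    (use list_map_inverse[of L M] list_map_inverse[of M L] assms in auto)

lemma card_pm_set:
  assumes "abs_distinct L"
  shows "card (pm_set L) = 2 * length L" "card (pos_part (pm_set L)) = length L"
    "pos_part (pm_set L) = abs ` set L"
proof -
  have L: "0 \<notin> set L" "distinct (map abs L)" using assms by (auto simp: abs_distinct_def)
  show pos: "pos_part (pm_set L) = abs ` set L"
    by (auto simp: pos_part_def pm_set_eq image_iff abs_if) (metis L(1) linorder_neqE_linordered_idom | force)+
  show pos_card: "card (pos_part (pm_set L)) = length L"
    unfolding pos using distinct_card[OF L(2)] by simp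
  show "card (pm_set L) = 2 * length L"
    using card_sym_set[OF sym_set_pm_set[OF assms], of "\<lambda>_. True"] pos_card by simp
qed

text \<open>Each entry goes to the next and the last one to \<open>\<epsilon>\<close> times the
  first. Writing this as a transport from the list to its signed rotation gives oddness and
  bijectivity from the general facts on \<open>list_map\<close>.\<close>

definition list_cycle :: "int list \<Rightarrow> int \<Rightarrow> int \<Rightarrow> int" where
  "list_cycle L \<epsilon> = list_map L (tl L @ [\<epsilon> * hd L])"

definition trace :: "(int \<Rightarrow> int) \<Rightarrow> int \<Rightarrow> int list" where
  "trace w a = map (\<lambda>t. (w ^^ t) a) [0..<blen w a]"

lemma abs_distinct_rotate:
  assumes "abs_distinct L" "L \<noteq> []" "\<epsilon> \<in> Z2"
  shows "abs_distinct (tl L @ [\<epsilon> * hd L])" "pm_set (tl L @ [\<epsilon> * hd L]) = pm_set L"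
proof -
  obtain b M where L: "L = b # M" using assms(2) by (cases L) auto
  have "\<bar>\<epsilon> * b\<bar> = \<bar>b\<bar>" "\<epsilon> * b = b \<or> \<epsilon> * b = - b" using assms(3) by (auto simp: Z2_def)
  then show "abs_distinct (tl L @ [\<epsilon> * hd L])" "pm_set (tl L @ [\<epsilon> * hd L]) = pm_set L"
    using assms(1) by (auto simp: L abs_distinct_def pm_set_eq)
qed

lemma list_cycle_signed_perm:
  assumes "abs_distinct L" "L \<noteq> []" "\<epsilon> \<in> Z2"
  shows "list_cycle L \<epsilon> \<in> signed_perms (pm_set L)"
proof -
  have "bij_betw (list_cycle L \<epsilon>) (pm_set L) (pm_set L)"
    unfolding list_cycle_def using list_map_bij_betw[of L "tl L @ [\<epsilon> * hd L]"]
      abs_distinct_rotate[OF assms] assms by simp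
  then have "list_cycle L \<epsilon> permutes pm_set L"
    by (rule bij_imp_permutes) (simp add: list_cycle_def list_map_outside)
  then show ?thesis
    by (simp add: signed_perms_def list_cycle_def list_map_minus)
qed

lemma list_cycle_nth:
  assumes "abs_distinct L" "t < length L"
  shows "list_cycle L \<epsilon> (L ! t) = (if Suc t < length L then L ! Suc t else \<epsilon> * L ! 0)"
  using assms by (cases L) (auto simp: list_cycle_def list_map_nth nth_append)

lemma abs_distinct_trace:
  assumes "sym_set S" "w \<in> signed_perms S" "a \<in> S"
  shows "abs_distinct (trace w a)" "set (trace w a) \<subseteq> S" "trace w a \<noteq> []" "hd (trace w a) = a"
proof -
  interpret signed_perm S w by unfold_locales fact+
  show sub: "set (trace w a) \<subseteq> S" using assms(3) by (auto simp: trace_def)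
  show "trace w a \<noteq> []" using blen_pos[of a] by (auto simp: trace_def)
  show "hd (trace w a) = a" using blen_pos[of a] by (simp add: trace_def upt_rec)
  have "distinct (map abs (trace w a))"
    using funpow_abs_inj[of _ a] by (auto simp: trace_def distinct_map inj_on_def)
  then show "abs_distinct (trace w a)" using sub zero_notin by (auto simp: abs_distinct_def)
qed

lemma signed_perms_mono: "A \<subseteq> B \<Longrightarrow> signed_perms A \<subseteq> signed_perms B"
  by (auto simp: signed_perms_def intro: permutes_subset)

context
  fixes S :: "int set" and L :: "int list" and \<epsilon> :: int
  assumes S: "sym_set S" and L: "abs_distinct L" "L \<noteq> []" "set L \<subseteq> S" and \<epsilon>: "\<epsilon> \<in> Z2"
begin

abbreviation (input) "Lc \<equiv> list_cycle L \<epsilon>"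
abbreviation (input) "LC \<equiv> pm_set L"

lemma pm_set_subset: "LC \<subseteq> S"
  using S L(3) by (auto simp: pm_set_eq sym_set_def)

lemma sym_set_rest: "sym_set (S - LC)"
  using S by (auto simp: sym_set_def)

lemma list_cycle_funpow:
  assumes "\<forall>x\<in>LC. w x = Lc x"
  shows "t < length L \<Longrightarrow> (w ^^ t) (hd L) = L ! t" "(w ^^ length L) (hd L) = \<epsilon> * hd L"
proof -
  have hd: "hd L = L ! 0" using L(2) by (rule hd_conv_nth)
  show nth: "t < length L \<Longrightarrow> (w ^^ t) (hd L) = L ! t" for t
  proof (induction t)
    case (Suc t)
    then show ?case
      using assms nth_in_pm_set[of t L] list_cycle_nth[OF L(1), of t] by simp
  qed (simp add: hd)
  define m where "m = length L - 1"
  have m: "length L = Suc m" "m < length L" using L(2) by (auto simp: m_def)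
  show "(w ^^ length L) (hd L) = \<epsilon> * hd L"
    using nth[OF m(2)] assms nth_in_pm_set[OF m(2)] list_cycle_nth[OF L(1) m(2)]
    by (simp add: m(1) hd)
qed

text \<open>The trace and the class at one point fix the permutation on the whole block and say
  nothing about it elsewhere; this describes the fibres over which the sum is later split.\<close>

lemma trace_eq_iff:
  assumes w: "w \<in> signed_perms S"
  shows "trace w (hd L) = L \<and> bcl w (hd L) = \<epsilon> \<longleftrightarrow> (\<forall>x\<in>LC. w x = Lc x)"
proof
  interpret signed_perm S w by unfold_locales fact+
  have hd: "hd L = L ! 0" using L(2) by (rule hd_conv_nth)
  assume tr: "trace w (hd L) = L \<and> bcl w (hd L) = \<epsilon>"
  then have len: "blen w (hd L) = length L" by (metis trace_def length_map length_upt minus_nat.diff_0)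
  have pow: "(w ^^ t) (hd L) = L ! t" if "t < length L" for t
    using that len tr by (metis trace_def nth_map nth_upt plus_nat.add_0 length_upt minus_nat.diff_0)
  have w_nth: "w (L ! t) = Lc (L ! t)" if t: "t < length L" for t
  proof (cases "Suc t < length L")
    case True
    then show ?thesis using pow[OF t] pow[OF True] list_cycle_nth[OF L(1) t] by simp
  next
    case False
    then have "Suc t = blen w (hd L)" using t len by simp
    then have "w (L ! t) = \<epsilon> * hd L"
      using funpow_blen[of "hd L"] pow[OF t] tr by (metis comp_apply funpow.simps(2))
    then show ?thesis using False list_cycle_nth[OF L(1) t] hd by simp
  qed
  have w_minus: "w (- x) = - w x" for x using w by (simp add: signed_perms_def)
  show "\<forall>x\<in>LC. w x = Lc x"
  proof
    fix x assume "x \<in> LC"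
    then obtain t where "t < length L" "x = L ! t \<or> x = - (L ! t)" by (rule pm_set_cases)
    then show "w x = Lc x"
      using w_nth w_minus by (auto simp: list_cycle_def list_map_minus)
  qed
next
  interpret signed_perm S w by unfold_locales fact+
  have hd: "hd L = L ! 0" using L(2) by (rule hd_conv_nth)
  assume ww: "\<forall>x\<in>LC. w x = Lc x"
  note pow = list_cycle_funpow[OF ww]
  have hdS: "hd L \<in> S" using L(2,3) by (cases L) auto
  have len: "blen w (hd L) = length L"
    unfolding blen_def
  proof (rule Least_equality)
    show "0 < length L \<and> (w ^^ length L) (hd L) \<in> {hd L, - hd L}"
      using L(2) pow(2) \<epsilon> by (auto simp: Z2_def)
    fix t assume t: "0 < t \<and> (w ^^ t) (hd L) \<in> {hd L, - hd L}"
    show "length L \<le> t"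
    proof (rule ccontr)
      assume "\<not> length L \<le> t"
      then have "t < length L" by simp
      with pow(1) t have "\<bar>L ! t\<bar> = \<bar>L ! 0\<bar>" by (auto simp: hd abs_eq_iff)
      then have "t = 0" using \<open>t < length L\<close> by (intro abs_distinct_nth_eq[OF L(1)]) auto
      with t show False by simp
    qed
  qed
  moreover have "bcl w (hd L) = \<epsilon>"
    by (rule bcl_eqI[OF hdS]) (simp add: len pow(2))
  moreover have "trace w (hd L) = L"
    by (rule nth_equalityI) (simp_all add: trace_def len pow(1))
  ultimately show "trace w (hd L) = L \<and> bcl w (hd L) = \<epsilon>" by simp
qed

definition glue :: "(int \<Rightarrow> int) \<Rightarrow> int \<Rightarrow> int" where
  "glue v x = (if x \<in> LC then Lc x else v x)"

lemma list_cycle_in: "Lc x \<in> LC \<longleftrightarrow> x \<in> LC"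
  using list_cycle_signed_perm[OF L(1,2) \<epsilon>] by (auto simp: signed_perms_def permutes_in_image)

text \<open>The two maps have disjoint supports. The case form of \<open>glue\<close> shows
  trajectories, while the composition shows membership in the group.\<close>

lemma glue_eq_comp:
  assumes "v \<in> signed_perms (S - LC)"
  shows "glue v = Lc \<circ> v"
proof
  fix x
  have v: "v permutes (S - LC)" using assms by (simp add: signed_perms_def)
  show "glue v x = (Lc \<circ> v) x"
  proof (cases "x \<in> LC")
    case True
    then show ?thesis using permutes_not_in[OF v, of x] by (simp add: glue_def)
  next
    case False
    then have "v x \<notin> LC" using permutes_in_image[OF v, of x] permutes_not_in[OF v, of x] by force
    then show ?thesis using False by (simp add: glue_def list_cycle_def list_map_outside)
  qed
qed

lemma glue_signed_perm:
  assumes "v \<in> signed_perms (S - LC)"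
  shows "glue v \<in> signed_perms S"
  unfolding glue_eq_comp[OF assms]
  using list_cycle_signed_perm[OF L(1,2) \<epsilon>] signed_perms_mono[OF pm_set_subset]
    signed_perms_mono[of "S - LC" S] assms by (intro signed_perms_comp) auto

text \<open>The inverse replaces the prescribed cycle by the identity. The remainder is again a
  permutation because a member of the fibre maps \<open>pm_set L\<close> onto itself, hence also its
  complement.\<close>

lemma glue_bij:
  "bij_betw glue (signed_perms (S - LC))
     {w \<in> signed_perms S. trace w (hd L) = L \<and> bcl w (hd L) = \<epsilon>}" (is "bij_betw _ ?V ?W")
proof (rule bij_betw_byWitness[where f' = "\<lambda>w x. if x \<in> LC then x else w x"])
  show "\<forall>v\<in>?V. (\<lambda>x. if x \<in> LC then x else glue v x) = v"
  proof (rule ballI, rule ext)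
    fix v x assume "v \<in> ?V"
    then have "v permutes (S - LC)" by (simp add: signed_perms_def)
    from permutes_not_in[OF this, of x]
    show "(if x \<in> LC then x else glue v x) = v x" by (simp add: glue_def)
  qed
  show "\<forall>w\<in>?W. glue (\<lambda>x. if x \<in> LC then x else w x) = w"
  proof
    fix w assume "w \<in> ?W"
    then have "\<forall>x\<in>LC. w x = Lc x" using trace_eq_iff by blast
    then show "glue (\<lambda>x. if x \<in> LC then x else w x) = w" by (auto simp: glue_def)
  qed
  show "glue ` ?V \<subseteq> ?W"
    using trace_eq_iff[OF glue_signed_perm] glue_signed_perm by (auto simp: glue_def)
  show "(\<lambda>w x. if x \<in> LC then x else w x) ` ?W \<subseteq> ?V"
  proof (rule image_subsetI)
    fix w assume "w \<in> ?W"
    then have w: "w \<in> signed_perms S" "\<forall>x\<in>LC. w x = Lc x"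
      using trace_eq_iff by auto
    then have wS: "w permutes S" "\<And>i. w (- i) = - w i" by (auto simp: signed_perms_def)
    let ?v = "\<lambda>x. if x \<in> LC then x else w x"
    have img: "w ` LC = LC"
      using w(2) list_cycle_signed_perm[OF L(1,2) \<epsilon>]
      by (simp add: signed_perms_def) (metis (no_types, lifting) image_cong permutes_image)
    have "bij_betw w (S - LC) (S - LC)"
    proof -
      have "bij_betw w (S - LC) (w ` (S - LC))"
        using permutes_inj[OF wS(1)] by (simp add: bij_betw_def inj_on_def inj_def)
      moreover have "w ` (S - LC) = S - LC"
        using permutes_inj[OF wS(1)] img permutes_image[OF wS(1)] by (simp add: image_set_diff)
      ultimately show ?thesis by simp
    qed
    then have "bij_betw ?v (S - LC) (S - LC)"
      by (subst bij_betw_cong[of _ _ w]) auto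
    then have "?v permutes (S - LC)"
      using wS(1) by (intro bij_imp_permutes) (auto simp: permutes_not_in)
    then show "?v \<in> ?V" using wS(2) by (simp add: signed_perms_def)
  qed
qed

lemma glue_funpow_outside:
  assumes "v \<in> signed_perms (S - LC)" "x \<notin> LC"
  shows "(glue v ^^ t) x = (v ^^ t) x"
proof (induction t)
  case (Suc t)
  have "v ^^ t permutes (S - LC)"
    using signed_perms_funpow[OF assms(1)] by (simp add: signed_perms_def)
  then have "(v ^^ t) x \<notin> LC"
    using assms(2) by (metis DiffD2 permutes_in_image permutes_not_in)
  then show ?case using Suc by (simp add: glue_def)
qed simp

lemma glue_blen_bcl_outside:
  assumes "v \<in> signed_perms (S - LC)" "x \<notin> LC"
  shows "blen (glue v) x = blen v x" "bcl (glue v) x = bcl v x"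
  using blen_bcl_cong[OF glue_funpow_outside[OF assms]] by auto

text \<open>Length and class are known at the head of the list from \<open>trace_eq_iff\<close>; as
  the block of the head is all of \<open>pm_set L\<close>, they carry over to every point of
  it.\<close>

lemma glue_blen_bcl_inside:
  assumes "v \<in> signed_perms (S - LC)" "x \<in> LC"
  shows "blen (glue v) x = length L" "bcl (glue v) x = \<epsilon>"
proof -
  interpret signed_perm S "glue v"
    by unfold_locales (use S glue_signed_perm assms in auto)
  have tr: "trace (glue v) (hd L) = L \<and> bcl (glue v) (hd L) = \<epsilon>"
    by (subst trace_eq_iff) (use glue_signed_perm assms in \<open>auto simp: glue_def\<close>)
  then have len: "blen (glue v) (hd L) = length L"
    by (metis trace_def length_map length_upt minus_nat.diff_0)
  have "block (glue v) (hd L) = LC"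
    unfolding block_eq_abs len pm_set_def
    using list_cycle_funpow(1)[of "glue v"] by (auto simp: glue_def)
  with assms(2) have "x \<in> block (glue v) (hd L)" by simp
  moreover have "hd L \<in> S" using L by (cases L) auto
  ultimately show "blen (glue v) x = length L" "bcl (glue v) x = \<epsilon>"
    using block_mem(3,4) tr len by auto
qed

text \<open>By oddness the factor at the absolute value of an entry is the sign of that entry times
  the sign of its image, the next entry. Around the cycle every sign occurs twice and cancels, and
  only the closing sign remains.\<close>

lemma prod_sgn_cycle: "(\<Prod>i\<in>pos_part LC. sgn (Lc i)) = \<epsilon>"
proof -
  have hd: "hd L = L ! 0" using L(2) by (rule hd_conv_nth)
  have nz: "sgn (L ! t) * sgn (L ! t) = 1" if "t < length L" for t
    using abs_distinct_nth_nonzero[OF L(1) that] by (simp add: sgn_mult_self_eq)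
  define m where "m = length L - 1"
  have m: "length L = Suc m" using L(2) by (auto simp: m_def)
  have "(\<Prod>i\<in>pos_part LC. sgn (Lc i)) = (\<Prod>t<length L. sgn (Lc \<bar>L ! t\<bar>))"
  proof (rule prod.reindex_bij_betw[symmetric])
    show "bij_betw (\<lambda>t. \<bar>L ! t\<bar>) {..<length L} (pos_part LC)"
      unfolding card_pm_set(3)[OF L(1)]
      by (rule bij_betw_imageI)
        (auto simp: inj_on_def set_conv_nth intro: abs_distinct_nth_eq[OF L(1)])
  qed
  also have "\<dots> = (\<Prod>t<length L. sgn (L ! t) * sgn (Lc (L ! t)))"
  proof (rule prod.cong)
    fix t assume "t \<in> {..<length L}"
    then have "L ! t \<noteq> 0" using abs_distinct_nth_nonzero[OF L(1)] by auto
    then show "sgn (Lc \<bar>L ! t\<bar>) = sgn (L ! t) * sgn (Lc (L ! t))"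
      by (cases "L ! t > 0") (auto simp: list_cycle_def list_map_minus abs_if sgn_if)
  qed simp
  also have "\<dots> = (\<Prod>t<length L. sgn (L ! t)) * (\<Prod>t<length L. sgn (Lc (L ! t)))"
    by (rule prod.distrib)
  also have "(\<Prod>t<length L. sgn (L ! t)) = sgn (L ! 0) * (\<Prod>t<m. sgn (L ! Suc t))"
    unfolding m by (rule prod.lessThan_Suc_shift)
  also have "(\<Prod>t<length L. sgn (Lc (L ! t))) = (\<Prod>t<m. sgn (L ! Suc t)) * (\<epsilon> * sgn (L ! 0))"
    using list_cycle_nth[OF L(1)] \<epsilon> by (auto simp: m sgn_mult Z2_def)
  also have "sgn (L ! 0) * (\<Prod>t<m. sgn (L ! Suc t)) * ((\<Prod>t<m. sgn (L ! Suc t)) * (\<epsilon> * sgn (L ! 0)))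
      = (sgn (L ! 0) * sgn (L ! 0)) * (\<Prod>t<m. sgn (L ! Suc t) * sgn (L ! Suc t)) * \<epsilon>"
    unfolding prod.distrib by (simp only: ac_simps)
  also have "\<dots> = \<epsilon>" using nz m by (simp del: sgn_mult_self_eq)
  finally show ?thesis .
qed

end

section \<open>The recursion for weighted sums over signed permutations\<close>

text \<open>The exponent \<open>e\<close> selects the linear character: 1 gives the character of the
  theorem, 0 the trivial one, with which the group order is computed. \<open>T\<close> stays
  abstract because the recursion uses only that each point contributes according to the length and
  class of its cycle.\<close>

definition cycle_weight ::
    "nat \<Rightarrow> (nat \<Rightarrow> int \<Rightarrow> 'a::comm_ring_1) \<Rightarrow> int set \<Rightarrow> (int \<Rightarrow> int) \<Rightarrow> 'a" where
  "cycle_weight e T S w = (\<Prod>i\<in>pos_part S. of_int (sgn (w i) ^ e) * T (blen w i) (bcl w i))"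

definition weight_sum ::
    "nat \<Rightarrow> (nat \<Rightarrow> int \<Rightarrow> 'a::comm_ring_1) \<Rightarrow> int set \<Rightarrow> 'a" where
  "weight_sum e T S = (\<Sum>w\<in>signed_perms S. cycle_weight e T S w)"

definition signed_lists :: "int set \<Rightarrow> nat \<Rightarrow> int list set" where
  "signed_lists S m = {L. set L \<subseteq> S \<and> distinct (map abs L) \<and> length L = m}"

text \<open>The product splits along the positive points of the cycle and of the rest. On the cycle
  the signs telescope to \<open>\<epsilon>\<close>, and \<open>T\<close> occurs once for each of the
  \<open>length L\<close> positive points; elsewhere the glued map agrees with
  \<open>v\<close>.\<close>

lemma cycle_weight_glue:
  fixes T :: "nat \<Rightarrow> int \<Rightarrow> 'a::comm_ring_1"
  assumes S: "sym_set S" and L: "abs_distinct L" "L \<noteq> []" "set L \<subseteq> S" and \<epsilon>: "\<epsilon> \<in> Z2"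
    and v: "v \<in> signed_perms (S - pm_set L)"
  shows "cycle_weight e T S (glue L \<epsilon> v)
    = of_int (\<epsilon> ^ e) * T (length L) \<epsilon> ^ length L * cycle_weight e T (S - pm_set L) v"
proof -
  let ?C = "pm_set L" and ?g = "glue L \<epsilon> v"
  let ?h = "\<lambda>i. of_int (sgn (?g i) ^ e) * T (blen ?g i) (bcl ?g i)"
  have C: "?C \<subseteq> S" by (rule pm_set_subset[OF S L \<epsilon>])
  have fin: "finite S" using S by (simp add: sym_set_def)
  have split: "pos_part S = pos_part ?C \<union> pos_part (S - ?C)"
    using C by (auto simp: pos_part_def)
  have "cycle_weight e T S ?g = (\<Prod>i\<in>pos_part ?C. ?h i) * (\<Prod>i\<in>pos_part (S - ?C). ?h i)"
    unfolding cycle_weight_def split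
    by (rule prod.union_disjoint) (use fin C in \<open>auto simp: pos_part_def intro: finite_subset\<close>)
  also have "(\<Prod>i\<in>pos_part (S - ?C). ?h i) = cycle_weight e T (S - ?C) v"
    unfolding cycle_weight_def
    by (rule prod.cong)
      (auto simp: pos_part_def glue_blen_bcl_outside[OF S L \<epsilon> v] glue_def[OF S L \<epsilon>])
  also have "(\<Prod>i\<in>pos_part ?C. ?h i)
      = (\<Prod>i\<in>pos_part ?C. of_int (sgn (list_cycle L \<epsilon> i) ^ e) * T (length L) \<epsilon>)"
    by (rule prod.cong)
      (auto simp: pos_part_def glue_blen_bcl_inside[OF S L \<epsilon> v] glue_def[OF S L \<epsilon>])
  also have "\<dots> = of_int ((\<Prod>i\<in>pos_part ?C. sgn (list_cycle L \<epsilon> i)) ^ e) * T (length L) \<epsilon> ^ length L"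
    by (simp add: prod.distrib card_pm_set(2)[OF L(1)] prod_power_distrib)
  also have "(\<Prod>i\<in>pos_part ?C. sgn (list_cycle L \<epsilon> i)) = \<epsilon>"
    by (rule prod_sgn_cycle[OF S L \<epsilon>])
  finally show ?thesis .
qed

section \<open>Counting the lists that describe a cycle\<close>

lemma finite_signed_lists: "finite S \<Longrightarrow> finite (signed_lists S m)"
  by (rule finite_subset[OF _ finite_lists_length_eq[of S m]]) (auto simp: signed_lists_def)

lemma sym_set_remove: "sym_set S \<Longrightarrow> sym_set (S - {b, - b})"
  by (auto simp: sym_set_def)

lemma card_remove:
  assumes "sym_set S" "b \<in> S"
  shows "card (S - {b, - b}) = card S - 2"
proof -
  have "b \<noteq> - b" "{b, - b} \<subseteq> S" "finite S" using assms by (auto simp: sym_set_def)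
  then show ?thesis by (subst card_Diff_subset) auto
qed

lemma signed_lists_Suc:
  "{L \<in> signed_lists S (Suc m). hd L = b} = (if b \<in> S then Cons b ` signed_lists (S - {b, - b}) m else {})"
proof -
  have "L \<in> {L \<in> signed_lists S (Suc m). hd L = b} \<longleftrightarrow>
      b \<in> S \<and> (\<exists>K\<in>signed_lists (S - {b, - b}) m. L = b # K)" for L
    by (cases L) (auto simp: signed_lists_def image_iff abs_eq_iff)
  then show ?thesis by auto
qed

text \<open>Choosing the entries one by one leaves 2r, 2(r-1), ... possibilities, since each choice
  uses up a point and its negative. The quotient of factorials is cleared so that the count stays in
  the natural numbers.\<close>

lemma card_signed_lists:
  assumes "sym_set S" "card S = 2 * r" "m \<le> r"
  shows "card (signed_lists S m) * fact (r - m) = 2 ^ m * fact r"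
  using assms
proof (induction m arbitrary: S r)
  case 0
  have "signed_lists S 0 = {[]}" by (auto simp: signed_lists_def)
  then show ?case by simp
next
  case (Suc m)
  have fin: "finite S" using Suc.prems by (simp add: sym_set_def)
  have "(\<Union>b\<in>S. {L \<in> signed_lists S (Suc m). hd L = b}) = signed_lists S (Suc m)"
    by (auto simp: signed_lists_def length_Suc_conv)
  then have "card (signed_lists S (Suc m)) = card (\<Union>b\<in>S. {L \<in> signed_lists S (Suc m). hd L = b})"
    by simp
  also have "\<dots> = (\<Sum>b\<in>S. card {L \<in> signed_lists S (Suc m). hd L = b})"
    by (rule card_UN_disjoint) (use fin finite_signed_lists[OF fin] in auto)
  also have "\<dots> = (\<Sum>b\<in>S. card (signed_lists (S - {b, - b}) m))"
    by (intro sum.cong) (simp_all add: signed_lists_Suc card_image)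
  finally have "card (signed_lists S (Suc m)) * fact (r - Suc m)
      = (\<Sum>b\<in>S. card (signed_lists (S - {b, - b}) m) * fact (r - 1 - m))"
    by (simp add: sum_distrib_right)
  also have "\<dots> = (\<Sum>b\<in>S. 2 ^ m * fact (r - 1))"
    by (intro sum.cong refl Suc.IH)
      (use Suc.prems in \<open>auto simp: sym_set_remove card_remove\<close>)
  also have "\<dots> = 2 ^ Suc m * fact r"
    using Suc.prems(2,3) by (cases r) (auto simp: algebra_simps)
  finally show ?case .
qed

text \<open>The number of ways to choose the cycle through a given point, up to its class.\<close>

definition cycle_count :: "nat \<Rightarrow> nat \<Rightarrow> nat" where
  "cycle_count n l = 2 ^ (l - 1) * fact (n - 1) div fact (n - l)"

text \<open>The natural division in \<open>cycle_count\<close> is exact: l at least 1 gives n - l at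
  most n - 1.\<close>

lemma cycle_count_fact:
  assumes "1 \<le> l" "l \<le> n"
  shows "cycle_count n l * fact (n - l) = 2 ^ (l - 1) * fact (n - 1)"
proof -
  have "(fact (n - l) :: nat) dvd fact (n - 1)" using assms by (intro fact_dvd) auto
  then show ?thesis by (simp add: cycle_count_def)
qed

text \<open>Fixing the head uses up one of the n pairs, leaving l - 1 entries to be chosen from n -
  1 pairs; hence the exponent l - 1 and the factorial of n - 1.\<close>

lemma card_signed_lists_hd:
  assumes "sym_set S" "card S = 2 * n" "a \<in> S" "1 \<le> l" "l \<le> n"
  shows "card {L \<in> signed_lists S l. hd L = a} = cycle_count n l"
proof -
  obtain m where m: "l = Suc m" using assms(4) by (cases l) auto
  have "card (signed_lists (S - {a, - a}) m) * fact (n - 1 - m) = 2 ^ m * fact (n - 1)"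
    by (rule card_signed_lists) (use assms m in \<open>auto simp: sym_set_remove card_remove\<close>)
  then have "card {L \<in> signed_lists S l. hd L = a} * fact (n - l) = cycle_count n l * fact (n - l)"
    using assms by (simp add: m signed_lists_Suc card_image cycle_count_fact)
  then show ?thesis by simp
qed

text \<open>The signed permutations are sorted by trace and class at \<open>a\<close>. Gluing
  identifies each fibre with the signed permutations of the remaining set, so lists of equal length
  contribute equally once smaller sums depend only on the size of the set. That dependence is a
  hypothesis here because it is itself proved by induction from this step.\<close>

lemma weight_sum_step:
  fixes T :: "nat \<Rightarrow> int \<Rightarrow> 'a::comm_ring_1"
  assumes S: "sym_set S" "card S = 2 * n" and a: "a \<in> S"
    and rest: "\<And>S' m. sym_set S' \<Longrightarrow> card S' = 2 * m \<Longrightarrow> m < n \<Longrightarrow> weight_sum e T S' = A m"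
  shows "weight_sum e T S
    = (\<Sum>l = 1..n. of_nat (cycle_count n l) * ((\<Sum>\<epsilon>\<in>Z2. of_int (\<epsilon> ^ e) * T l \<epsilon> ^ l) * A (n - l)))"
proof -
  define \<Lambda> where "\<Lambda> l = {L \<in> signed_lists S l. hd L = a}" for l
  let ?\<Lambda> = "\<Union>l\<in>{1..n}. \<Lambda> l"
  let ?V = "\<lambda>l. \<Sum>\<epsilon>\<in>Z2. of_int (\<epsilon> ^ e) * T l \<epsilon> ^ l"
  have fin: "finite S" "0 \<notin> S" using S by (auto simp: sym_set_def)
  have fin_\<Lambda>: "finite (\<Lambda> l)" for l using finite_signed_lists[OF fin(1)] by (simp add: \<Lambda>_def)
  have finZ: "finite Z2" by (simp add: Z2_def)
  have L_props: "abs_distinct L" "L \<noteq> []" "set L \<subseteq> S" "hd L = a" "length L = l" "1 \<le> l"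
    if "L \<in> \<Lambda> l" "l \<in> {1..n}" for L l
    using that fin(2) by (auto simp: \<Lambda>_def signed_lists_def abs_distinct_def)
  have range: "(\<lambda>w. (trace w a, bcl w a)) ` signed_perms S \<subseteq> ?\<Lambda> \<times> Z2"
  proof (rule image_subsetI)
    fix w assume w: "w \<in> signed_perms S"
    note tr = abs_distinct_trace[OF S(1) w a]
    \<comment> \<open>The trace and its negative fit into \<open>S\<close>, which bounds the length
      of the cycle by n.\<close>
    have "2 * length (trace w a) \<le> 2 * n"
      unfolding card_pm_set(1)[OF tr(1), symmetric] S(2)[symmetric]
      using fin(1) tr S(1) by (intro card_mono) (auto simp: pm_set_eq sym_set_def)
    moreover have "1 \<le> length (trace w a)" using tr(3) by (cases "trace w a") auto
    ultimately have "trace w a \<in> ?\<Lambda>"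
      using tr by (auto simp: \<Lambda>_def signed_lists_def abs_distinct_def)
    then show "(trace w a, bcl w a) \<in> ?\<Lambda> \<times> Z2" using bcl_Z2 by simp
  qed
  have fibre: "(\<Sum>w\<in>{w \<in> signed_perms S. (trace w a, bcl w a) = (L, \<epsilon>)}. cycle_weight e T S w)
      = of_int (\<epsilon> ^ e) * T l \<epsilon> ^ l * A (n - l)"
    if L: "L \<in> \<Lambda> l" and l: "l \<in> {1..n}" and \<epsilon>: "\<epsilon> \<in> Z2" for L l \<epsilon>
  proof -
    note Lp = L_props[OF L l]
    have "card (S - pm_set L) = 2 * (n - l)"
      using card_Diff_subset[of "pm_set L" S] pm_set_subset[OF S(1) Lp(1-3) \<epsilon>] fin(1)
        card_pm_set(1)[OF Lp(1)] Lp(5) S(2) by (simp add: finite_subset)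
    then have A: "weight_sum e T (S - pm_set L) = A (n - l)"
      using l by (intro rest sym_set_rest[OF S(1) Lp(1-3) \<epsilon>]) auto
    have "(\<Sum>w\<in>{w \<in> signed_perms S. (trace w a, bcl w a) = (L, \<epsilon>)}. cycle_weight e T S w)
        = (\<Sum>v\<in>signed_perms (S - pm_set L). cycle_weight e T S (glue L \<epsilon> v))"
      using sum.reindex_bij_betw[OF glue_bij[OF S(1) Lp(1-3) \<epsilon>], of "cycle_weight e T S"] Lp(4)
      by simp
    also have "\<dots> = (\<Sum>v\<in>signed_perms (S - pm_set L).
        of_int (\<epsilon> ^ e) * T l \<epsilon> ^ l * cycle_weight e T (S - pm_set L) v)"
      by (intro sum.cong refl) (simp add: cycle_weight_glue[OF S(1) Lp(1-3) \<epsilon>] Lp(5))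
    also have "\<dots> = of_int (\<epsilon> ^ e) * T l \<epsilon> ^ l * A (n - l)"
      unfolding A[symmetric] weight_sum_def by (simp add: sum_distrib_left)
    finally show ?thesis .
  qed
  have "weight_sum e T S = (\<Sum>p\<in>?\<Lambda> \<times> Z2.
      \<Sum>w\<in>{w \<in> signed_perms S. (trace w a, bcl w a) = p}. cycle_weight e T S w)"
    unfolding weight_sum_def
    by (rule sum.group[symmetric]) (use fin_\<Lambda> finZ range finite_signed_perms[OF fin(1)] in auto)
  also have "\<dots> = (\<Sum>L\<in>?\<Lambda>. \<Sum>\<epsilon>\<in>Z2.
      \<Sum>w\<in>{w \<in> signed_perms S. (trace w a, bcl w a) = (L, \<epsilon>)}. cycle_weight e T S w)"
    by (subst sum.cartesian_product) (simp add: case_prod_unfold prod_eq_iff)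
  also have "\<dots> = (\<Sum>l = 1..n. \<Sum>L\<in>\<Lambda> l. \<Sum>\<epsilon>\<in>Z2.
      \<Sum>w\<in>{w \<in> signed_perms S. (trace w a, bcl w a) = (L, \<epsilon>)}. cycle_weight e T S w)"
    by (rule sum.UNION_disjoint) (use fin_\<Lambda> in \<open>auto simp: \<Lambda>_def signed_lists_def\<close>)
  also have "\<dots> = (\<Sum>l = 1..n. \<Sum>L\<in>\<Lambda> l. ?V l * A (n - l))"
    by (intro sum.cong refl) (simp only: fibre sum_distrib_right cong: sum.cong)
  also have "\<dots> = (\<Sum>l = 1..n. of_nat (cycle_count n l) * (?V l * A (n - l)))"
    using card_signed_lists_hd[OF S a] by (intro sum.cong refl) (simp add: \<Lambda>_def)
  finally show ?thesis .
qed

lemma card_signed_set: "card (signed_set n) = 2 * n"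
proof -
  have "card (signed_set n) = card {- int n..int n} - card {0 :: int}"
    unfolding signed_set_def by (rule card_Diff_subset) auto
  then show ?thesis by simp
qed

text \<open>Given the claim for smaller sizes, the step expands both sums into the same expression
  in n alone, whatever base points are used.\<close>

lemma weight_sum_card:
  assumes "sym_set S" "card S = 2 * n"
  shows "weight_sum e T S = weight_sum e T (signed_set n)"
  using assms
proof (induction n arbitrary: S rule: less_induct)
  case (less n)
  show ?case
  proof (cases "n = 0")
    case True
    then have "S = signed_set n" using less.prems by (auto simp: sym_set_def signed_set_def)
    then show ?thesis by simp
  next
    case False
    then obtain a where a: "a \<in> S" using less.prems by fastforce
    have b: "1 \<in> signed_set n" using False by (auto simp: signed_set_def)
    show ?thesis
      using weight_sum_step[OF less.prems a, of e T "\<lambda>m. weight_sum e T (signed_set m)"]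
        weight_sum_step[OF sym_set_signed_set card_signed_set b, of e T "\<lambda>m. weight_sum e T (signed_set m)"]
        less.IH by simp
  qed
qed

lemma weight_sum_rec:
  assumes "0 < n"
  shows "weight_sum e T (signed_set n) = (\<Sum>l = 1..n. of_nat (cycle_count n l)
      * ((\<Sum>\<epsilon>\<in>Z2. of_int (\<epsilon> ^ e) * T l \<epsilon> ^ l) * weight_sum e T (signed_set (n - l))))"
  by (rule weight_sum_step[OF sym_set_signed_set card_signed_set, of 1])
    (use assms weight_sum_card in \<open>auto simp: signed_set_def\<close>)

lemma weight_sum_0 [simp]: "weight_sum e T (signed_set 0) = 1"
proof -
  have "signed_perms {} = {id}" by (auto simp: signed_perms_def)
  moreover have "signed_set 0 = {}" by (auto simp: signed_set_def)
  ultimately show ?thesis by (simp add: weight_sum_def cycle_weight_def pos_part_def)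
qed

text \<open>The recursion with trivial weights: each of its n summands equals 2^n (n-1)!.\<close>

lemma card_B_group: "card (B_group n) = 2 ^ n * fact n"
proof -
  let ?A = "\<lambda>n. weight_sum 0 (\<lambda>_ _. 1 :: int) (signed_set n)"
  have card: "?A n = int (card (B_group n))" for n
    by (simp add: weight_sum_def cycle_weight_def B_group_eq)
  have "?A n = 2 ^ n * fact n"
  proof (induction n rule: less_induct)
    case (less n)
    show ?case
    proof (cases "n = 0")
      case False
      have "?A n = (\<Sum>l = 1..n. int (cycle_count n l) * (2 * ?A (n - l)))"
        using weight_sum_rec[of n 0 "\<lambda>_ _. 1 :: int"] False by (simp add: Z2_def)
      also have "\<dots> = (\<Sum>l = 1..n. 2 ^ n * fact (n - 1))"
      proof (rule sum.cong)
        fix l assume l: "l \<in> {1..n}"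
        then have "int (cycle_count n l) * (2 * ?A (n - l))
            = 2 * 2 ^ (n - l) * int (cycle_count n l * fact (n - l))"
          using less[of "n - l"] by simp
        also have "\<dots> = 2 ^ n * fact (n - 1)"
          using l cycle_count_fact[of l n]
          by (simp add: power_add[symmetric] power_Suc[symmetric] del: power_Suc)
        finally show "int (cycle_count n l) * (2 * ?A (n - l)) = 2 ^ n * fact (n - 1)" .
      qed simp
      also have "\<dots> = 2 ^ n * fact n" using False by (simp add: fact_reduce)
      finally show ?thesis .
    qed simp
  qed
  then have "int (card (B_group n)) = int (2 ^ n * fact n)" by (simp add: card)
  then show ?thesis by (simp only: of_nat_eq_iff)
qed

section \<open>Equal cycle types are conjugate\<close>

text \<open>Points are counted rather than cycles because this number is additive under gluing; for
  positive j it determines the number of cycles through the factor 2 j.\<close>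

definition class_points :: "int set \<Rightarrow> (int \<Rightarrow> int) \<Rightarrow> nat \<Rightarrow> int \<Rightarrow> nat" where
  "class_points S w j \<theta> = card {x \<in> S. blen w x = j \<and> bcl w x = \<theta>}"

lemma class_points_glue:
  assumes S: "sym_set S" and L: "abs_distinct L" "L \<noteq> []" "set L \<subseteq> S" and \<epsilon>: "\<epsilon> \<in> Z2"
    and v: "v \<in> signed_perms (S - pm_set L)"
  shows "class_points S (glue L \<epsilon> v) j \<theta>
    = (if j = length L \<and> \<theta> = \<epsilon> then 2 * length L else 0) + class_points (S - pm_set L) v j \<theta>"
proof -
  let ?C = "pm_set L" and ?g = "glue L \<epsilon> v"
  let ?A = "{x \<in> ?C. j = length L \<and> \<theta> = \<epsilon>}"
  let ?B = "{x \<in> S - ?C. blen v x = j \<and> bcl v x = \<theta>}"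
  have C: "?C \<subseteq> S" by (rule pm_set_subset[OF S L \<epsilon>])
  have fin: "finite S" using S by (simp add: sym_set_def)
  have "{x \<in> S. blen ?g x = j \<and> bcl ?g x = \<theta>} = ?A \<union> ?B"
  proof (rule set_eqI)
    fix x
    show "x \<in> {x \<in> S. blen ?g x = j \<and> bcl ?g x = \<theta>} \<longleftrightarrow> x \<in> ?A \<union> ?B"
      using C glue_blen_bcl_inside[OF S L \<epsilon> v, of x] glue_blen_bcl_outside[OF S L \<epsilon> v, of x]
      by (cases "x \<in> ?C") auto
  qed
  moreover have "card (?A \<union> ?B) = card ?A + card ?B"
    by (rule card_Un_disjoint) (use fin C in \<open>auto intro: finite_subset\<close>)
  moreover have "card ?A = (if j = length L \<and> \<theta> = \<epsilon> then 2 * length L else 0)"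
    using card_pm_set(1)[OF L(1)] by (cases "j = length L \<and> \<theta> = \<epsilon>") auto
  ultimately show ?thesis by (simp add: class_points_def)
qed

lemma split_cycle:
  assumes S: "sym_set S" and w: "w \<in> signed_perms S" and a: "a \<in> S"
  obtains L v where "abs_distinct L" "L \<noteq> []" "set L \<subseteq> S" "length L = blen w a"
    "v \<in> signed_perms (S - pm_set L)" "w = glue L (bcl w a) v"
proof -
  note tr = abs_distinct_trace[OF S w a]
  have "w \<in> {w' \<in> signed_perms S. trace w' (hd (trace w a)) = trace w a
      \<and> bcl w' (hd (trace w a)) = bcl w a}"
    using w tr(4) by simp
  then obtain v where "v \<in> signed_perms (S - pm_set (trace w a))" "w = glue (trace w a) (bcl w a) v"
    using bij_betw_imp_surj_on[OF glue_bij[OF S tr(1,3,2) bcl_Z2[of w a]]] by blast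
  moreover have "length (trace w a) = blen w a" by (simp add: trace_def)
  ultimately show thesis using that tr by blast
qed

text \<open>Transport of entries commutes with passing to the next entry, and at the closing step
  with the sign, because \<open>list_map\<close> is odd.\<close>

lemma list_map_list_cycle:
  assumes "abs_distinct L" "abs_distinct M" "length L = length M" "\<epsilon> \<in> Z2" "x \<in> pm_set L"
  shows "list_map L M (list_cycle L \<epsilon> x) = list_cycle M \<epsilon> (list_map L M x)"
proof -
  have neg: "list_cycle K \<epsilon> (- x) = - list_cycle K \<epsilon> x" for K x
    by (simp add: list_cycle_def list_map_minus)
  obtain t where t: "t < length L" "x = L ! t \<or> x = - (L ! t)"
    using assms(5) by (rule pm_set_cases)
  have "list_map L M (list_cycle L \<epsilon> (L ! t)) = list_cycle M \<epsilon> (list_map L M (L ! t))"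
  proof (cases "Suc t < length L")
    case True
    then show ?thesis using assms t by (simp add: list_cycle_nth list_map_nth)
  next
    case False
    have "0 < length L" using t by auto
    with False show ?thesis
      using assms t by (auto simp: list_cycle_nth list_map_nth Z2_def list_map_minus)
  qed
  then show ?thesis using t(2) by (auto simp: neg list_map_minus)
qed

text \<open>Equal counts provide a point of the second set with the same length and class as a
  chosen point of the first. The two traces are matched entry by entry, the remainders by induction.
  Two sets are needed even for conjugacy within one group, as the removed blocks may differ.\<close>

lemma equal_class_points_conjugate:
  assumes "sym_set S\<^sub>1" "sym_set S\<^sub>2" "w\<^sub>1 \<in> signed_perms S\<^sub>1" "w\<^sub>2 \<in> signed_perms S\<^sub>2"
    and "\<And>j \<theta>. class_points S\<^sub>1 w\<^sub>1 j \<theta> = class_points S\<^sub>2 w\<^sub>2 j \<theta>"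
  shows "\<exists>\<phi>. (\<forall>x. \<phi> (- x) = - \<phi> x) \<and> bij_betw \<phi> S\<^sub>1 S\<^sub>2 \<and> (\<forall>x\<in>S\<^sub>1. \<phi> (w\<^sub>1 x) = w\<^sub>2 (\<phi> x))"
  using assms
proof (induction "card S\<^sub>1" arbitrary: S\<^sub>1 S\<^sub>2 w\<^sub>1 w\<^sub>2 rule: less_induct)
  case less
  note S1 = less.prems(1) and S2 = less.prems(2) and w1 = less.prems(3) and w2 = less.prems(4)
    and eq = less.prems(5)
  have fin: "finite S\<^sub>1" "finite S\<^sub>2" using S1 S2 by (auto simp: sym_set_def)
  have pos: "0 < class_points S w (blen w x) (bcl w x)" if "x \<in> S" "finite S" for S w x
    using that by (auto simp: class_points_def card_gt_0_iff)
  have ex: "\<exists>x\<in>S. blen w x = j \<and> bcl w x = \<theta>" if "0 < class_points S w j \<theta>" for S w j \<theta>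
    using that by (auto simp: class_points_def card_gt_0_iff)
  show ?case
  proof (cases "S\<^sub>1 = {}")
    case True
    have "S\<^sub>2 = {}"
    proof (rule ccontr)
      assume "S\<^sub>2 \<noteq> {}"
      then obtain x where "x \<in> S\<^sub>2" by auto
      from pos[OF this fin(2), of w\<^sub>2] ex[of S\<^sub>1] show False unfolding eq[symmetric] True by blast
    qed
    with True show ?thesis by (intro exI[of _ id]) simp
  next
    case False
    then obtain a\<^sub>1 where a1: "a\<^sub>1 \<in> S\<^sub>1" by auto
    obtain a\<^sub>2 where a2: "a\<^sub>2 \<in> S\<^sub>2" "blen w\<^sub>2 a\<^sub>2 = blen w\<^sub>1 a\<^sub>1" "bcl w\<^sub>2 a\<^sub>2 = bcl w\<^sub>1 a\<^sub>1"
      using ex[of S\<^sub>2 w\<^sub>2] pos[OF a1 fin(1), of w\<^sub>1] unfolding eq by blast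
    define \<epsilon> where "\<epsilon> = bcl w\<^sub>1 a\<^sub>1"
    have \<epsilon>: "\<epsilon> \<in> Z2" by (simp add: \<epsilon>_def bcl_Z2)
    obtain L v\<^sub>1 where L: "abs_distinct L" "L \<noteq> []" "set L \<subseteq> S\<^sub>1" "length L = blen w\<^sub>1 a\<^sub>1"
        and v1: "v\<^sub>1 \<in> signed_perms (S\<^sub>1 - pm_set L)" "w\<^sub>1 = glue L \<epsilon> v\<^sub>1"
      using split_cycle[OF S1 w1 a1] unfolding \<epsilon>_def by metis
    obtain M v\<^sub>2 where M: "abs_distinct M" "M \<noteq> []" "set M \<subseteq> S\<^sub>2" "length M = blen w\<^sub>1 a\<^sub>1"
        and v2: "v\<^sub>2 \<in> signed_perms (S\<^sub>2 - pm_set M)" "w\<^sub>2 = glue M \<epsilon> v\<^sub>2"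
      using split_cycle[OF S2 w2 a2(1)] unfolding a2(2,3) \<epsilon>_def by metis
    note g1 = glue_def[OF S1 L(1-3) \<epsilon>] and g2 = glue_def[OF S2 M(1-3) \<epsilon>]
    have C1: "pm_set L \<subseteq> S\<^sub>1" and C2: "pm_set M \<subseteq> S\<^sub>2"
      using pm_set_subset[OF S1 L(1-3) \<epsilon>] pm_set_subset[OF S2 M(1-3) \<epsilon>] by auto
    have LM: "length L = length M" using L(4) M(4) by simp
    have "hd L \<in> pm_set L" using L(2) by (auto simp: pm_set_eq)
    then have smaller: "card (S\<^sub>1 - pm_set L) < card S\<^sub>1"
      using fin(1) C1 by (intro psubset_card_mono) auto
    have "class_points (S\<^sub>1 - pm_set L) v\<^sub>1 j \<theta> = class_points (S\<^sub>2 - pm_set M) v\<^sub>2 j \<theta>" for j \<theta>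
      using eq[of j \<theta>]
      unfolding v1(2) v2(2) class_points_glue[OF S1 L(1-3) \<epsilon> v1(1)]
        class_points_glue[OF S2 M(1-3) \<epsilon> v2(1)] LM by simp
    from less.hyps[OF smaller sym_set_rest[OF S1 L(1-3) \<epsilon>] sym_set_rest[OF S2 M(1-3) \<epsilon>] v1(1) v2(1) this]
    obtain \<psi> where \<psi>: "\<And>x. \<psi> (- x) = - \<psi> x" "bij_betw \<psi> (S\<^sub>1 - pm_set L) (S\<^sub>2 - pm_set M)"
        "\<And>x. x \<in> S\<^sub>1 - pm_set L \<Longrightarrow> \<psi> (v\<^sub>1 x) = v\<^sub>2 (\<psi> x)"
      by metis
    \<comment> \<open>The two partial conjugators live on complementary pieces that are invariant
      under the permutations, so they can be put together by cases.\<close>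
    define \<phi> where "\<phi> x = (if x \<in> pm_set L then list_map L M x else \<psi> x)" for x
    have "bij_betw \<phi> (pm_set L) (pm_set M)"
      using list_map_bij_betw[OF L(1) M(1) LM] by (subst bij_betw_cong[of _ _ "list_map L M"]) (auto simp: \<phi>_def)
    moreover have "bij_betw \<phi> (S\<^sub>1 - pm_set L) (S\<^sub>2 - pm_set M)"
      using \<psi>(2) by (subst bij_betw_cong[of _ _ \<psi>]) (auto simp: \<phi>_def)
    ultimately have "bij_betw \<phi> (pm_set L \<union> (S\<^sub>1 - pm_set L)) (pm_set M \<union> (S\<^sub>2 - pm_set M))"
      by (rule bij_betw_combine) auto
    then have "bij_betw \<phi> S\<^sub>1 S\<^sub>2" using C1 C2 by (simp add: Un_absorb1)
    moreover have "\<phi> (- x) = - \<phi> x" for x by (simp add: \<phi>_def list_map_minus \<psi>(1))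
    moreover have "\<phi> (w\<^sub>1 x) = w\<^sub>2 (\<phi> x)" if x: "x \<in> S\<^sub>1" for x
    proof (cases "x \<in> pm_set L")
      case True
      then show ?thesis
        using list_map_list_cycle[OF L(1) M(1) LM \<epsilon> True] list_map_inverse[OF L(1) M(1) LM True]
          list_cycle_in[OF S1 L(1-3) \<epsilon>]
        by (simp add: \<phi>_def v1(2) v2(2) g1 g2)
    next
      case False
      have "v\<^sub>1 permutes (S\<^sub>1 - pm_set L)" using v1(1) by (simp add: signed_perms_def)
      then have "v\<^sub>1 x \<in> S\<^sub>1 - pm_set L" using x False permutes_in_image by fastforce
      moreover have "\<psi> x \<notin> pm_set M" using bij_betwE[OF \<psi>(2)] x False by blast
      ultimately show ?thesis
        using False x \<psi>(3)[of x] by (simp add: \<phi>_def v1(2) v2(2) g1 g2)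
    qed
    ultimately show ?thesis by blast
  qed
qed

text \<open>One part l is taken off, some list of length l is chosen as its cycle, and the rest is
  supplied by induction. Such a list exists because the counting formula makes the number of
  candidates nonzero.\<close>

lemma exists_class_points:
  fixes p :: "int \<Rightarrow> nat multiset"
  assumes "sym_set S" "card S = 2 * n" "\<forall>\<theta>\<in>Z2. 0 \<notin># p \<theta>" "(\<Sum>\<theta>\<in>Z2. sum_mset (p \<theta>)) = n"
  shows "\<exists>w\<in>signed_perms S. \<forall>\<theta>\<in>Z2. \<forall>j. class_points S w j \<theta> = 2 * j * count (p \<theta>) j"
  using assms
proof (induction n arbitrary: S p rule: less_induct)
  case (less n)
  note S = less.prems(1)
  have fin: "finite S" "0 \<notin> S" using S by (auto simp: sym_set_def)
  have finZ: "finite Z2" by (simp add: Z2_def)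
  show ?case
  proof (cases "\<forall>\<theta>\<in>Z2. p \<theta> = {#}")
    case True
    then have "S = {}" using less.prems(2,4) fin by simp
    with True show ?thesis by (intro bexI[of _ id]) (auto simp: class_points_def signed_perms_id)
  next
    case False
    then obtain \<epsilon> where \<epsilon>: "\<epsilon> \<in> Z2" "p \<epsilon> \<noteq> {#}" by blast
    then obtain l where l: "l \<in># p \<epsilon>" by (meson multiset_nonemptyE)
    note \<epsilon> = \<epsilon>(1)
    define p' where "p' = p(\<epsilon> := p \<epsilon> - {#l#})"
    have "l \<noteq> 0" using less.prems(3) \<epsilon> l by metis
    have add: "sum_mset (p \<epsilon>) = l + sum_mset (p' \<epsilon>)" using l by (simp add: p'_def sum_mset.remove)
    have "(\<Sum>\<theta>\<in>Z2 - {\<epsilon>}. sum_mset (p \<theta>)) = (\<Sum>\<theta>\<in>Z2 - {\<epsilon>}. sum_mset (p' \<theta>))"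
      by (rule sum.cong) (auto simp: p'_def)
    then have sum: "l + (\<Sum>\<theta>\<in>Z2. sum_mset (p' \<theta>)) = n"
      using sum.remove[OF finZ \<epsilon>, of "\<lambda>\<theta>. sum_mset (p \<theta>)"]
        sum.remove[OF finZ \<epsilon>, of "\<lambda>\<theta>. sum_mset (p' \<theta>)"] less.prems(4) add by linarith
    then have "l \<le> n" by linarith
    have smaller: "n - l < n" "(\<Sum>\<theta>\<in>Z2. sum_mset (p' \<theta>)) = n - l"
      using sum \<open>l \<noteq> 0\<close> by linarith+
    have "card (signed_lists S l) \<noteq> 0"
      using card_signed_lists[OF S less.prems(2) \<open>l \<le> n\<close>] by (metis fact_nonzero mult_eq_0_iff power_not_zero zero_neq_numeral)
    then have "signed_lists S l \<noteq> {}" by (metis card.empty)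
    then obtain L where "L \<in> signed_lists S l" by auto
    then have L: "abs_distinct L" "L \<noteq> []" "set L \<subseteq> S" and len: "length L = l"
      using \<open>l \<noteq> 0\<close> fin(2) by (auto simp: signed_lists_def abs_distinct_def)
    have C: "pm_set L \<subseteq> S" by (rule pm_set_subset[OF S L \<epsilon>])
    then have "card (S - pm_set L) = 2 * (n - l)"
      using fin(1) less.prems(2) card_pm_set(1)[OF L(1)] len
      by (subst card_Diff_subset) (auto intro: finite_subset)
    moreover have "\<forall>\<theta>\<in>Z2. 0 \<notin># p' \<theta>"
      using less.prems(3) by (auto simp: p'_def dest: in_diffD)
    ultimately obtain v where v: "v \<in> signed_perms (S - pm_set L)"
        "\<forall>\<theta>\<in>Z2. \<forall>j. class_points (S - pm_set L) v j \<theta> = 2 * j * count (p' \<theta>) j"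
      using less.IH[OF smaller(1) sym_set_rest[OF S L \<epsilon>] _ _ smaller(2)] by blast
    have "count (p \<theta>) j = (if j = l \<and> \<theta> = \<epsilon> then 1 else 0) + count (p' \<theta>) j" for \<theta> j
      using l by (auto simp: p'_def)
    then have "\<forall>\<theta>\<in>Z2. \<forall>j. class_points S (glue L \<epsilon> v) j \<theta> = 2 * j * count (p \<theta>) j"
      using v(2) class_points_glue[OF S L \<epsilon> v(1)] len by (simp add: distrib_left)
    then show ?thesis using glue_signed_perm[OF S L \<epsilon> v(1)] by blast
  qed
qed

section \<open>Averages over the hyperoctahedral group\<close>

lemma class_points_cycle_type:
  assumes w: "w \<in> B_group n" and \<theta>: "\<theta> \<in> Z2"
  shows "class_points (signed_set n) w j \<theta> = 2 * j * count (part_of_class (B_cycle_type n w) \<theta>) j"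
proof -
  interpret signed_perm "signed_set n" w
    by unfold_locales (use w in \<open>auto simp: B_group_eq\<close>)
  show ?thesis
    using card_class_points[of j \<theta>] fin
    by (simp add: class_points_def part_of_class_cycle_type[OF w \<theta>] count_image_mset_eq_card_vimage)
qed

lemma zero_not_in_cycle_type:
  assumes w: "w \<in> B_group n" and \<theta>: "\<theta> \<in> Z2"
  shows "0 \<notin># part_of_class (B_cycle_type n w) \<theta>"
proof -
  interpret signed_perm "signed_set n" w
    by unfold_locales (use w in \<open>auto simp: B_group_eq\<close>)
  show ?thesis
    using fin by (auto simp: part_of_class_cycle_type[OF w \<theta>] card_block) (metis blen_pos less_irrefl)
qed

lemma bipartition_eqI:
  "part_of_class \<mu> 1 = part_of_class \<nu> 1 \<Longrightarrow> part_of_class \<mu> (-1) = part_of_class \<nu> (-1) \<Longrightarrow> \<mu> = \<nu>"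
  by (simp add: part_of_class_def prod_eq_iff)

text \<open>For positive j the factor 2 j cancels and the multiplicities agree. At j = 0 the point
  count carries no information, which is why 0 is excluded as a part separately.\<close>

lemma cycle_type_eqI:
  assumes w: "w \<in> B_group n" and \<mu>: "\<And>\<theta>. \<theta> \<in> Z2 \<Longrightarrow> 0 \<notin># part_of_class \<mu> \<theta>"
    and points: "\<And>j \<theta>. \<theta> \<in> Z2 \<Longrightarrow> class_points (signed_set n) w j \<theta> = 2 * j * count (part_of_class \<mu> \<theta>) j"
  shows "B_cycle_type n w = \<mu>"
proof -
  have "part_of_class (B_cycle_type n w) \<theta> = part_of_class \<mu> \<theta>" if \<theta>: "\<theta> \<in> Z2" for \<theta>
  proof (rule multiset_eqI)
    fix j
    show "count (part_of_class (B_cycle_type n w) \<theta>) j = count (part_of_class \<mu> \<theta>) j"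
    proof (cases "j = 0")
      case True
      then show ?thesis
        using zero_not_in_cycle_type[OF w \<theta>] \<mu>[OF \<theta>] by (simp add: not_in_iff)
    next
      case False
      then show ?thesis
        using points[OF \<theta>, of j] class_points_cycle_type[OF w \<theta>, of j] by simp
    qed
  qed
  then show ?thesis by (intro bipartition_eqI) (auto simp: Z2_def)
qed

text \<open>Every part is half the size of its block and the blocks of one class partition the
  points of that class, so twice the sum of all parts is the total number 2 n of points.\<close>

lemma cycle_type_in_bipartitions:
  assumes w: "w \<in> B_group n"
  shows "B_cycle_type n w \<in> bipartitions n"
proof -
  interpret signed_perm "signed_set n" w
    by unfold_locales (use w in \<open>auto simp: B_group_eq\<close>)
  let ?S = "signed_set n" and ?\<mu> = "B_cycle_type n w"
  have sum: "2 * sum_mset (part_of_class ?\<mu> \<theta>) = card {x \<in> ?S. bcl w x = \<theta>}" if \<theta>: "\<theta> \<in> Z2" for \<theta>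
  proof -
    let ?X = "{x \<in> ?S. bcl w x = \<theta>}"
    have un: "\<Union> (block w ` ?X) = ?X"
      using self_in_block block_subset block_mem(4) by fastforce
    have "card (\<Union> (block w ` ?X)) = (\<Sum>C\<in>block w ` ?X. card C)"
    proof (rule card_Union_disjoint)
      show "pairwise disjnt (block w ` ?X)"
        unfolding pairwise_def disjnt_def
      proof (intro ballI impI)
        fix C D assume "C \<in> block w ` ?X" "D \<in> block w ` ?X" "C \<noteq> D"
        then show "C \<inter> D = {}" using block_mem(2) by blast
      qed
      show "finite C" if "C \<in> block w ` ?X" for C
        using that block_subset fin finite_subset by blast
    qed
    also have "\<dots> = (\<Sum>C\<in>block w ` ?X. 2 * (card C div 2))"
      by (rule sum.cong) (auto simp: card_block)
    finally show ?thesis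
      by (simp add: part_of_class_cycle_type[OF w \<theta>] un sum_unfold_sum_mset[symmetric] sum_distrib_left)
  qed
  have "?S = {x \<in> ?S. bcl w x = 1} \<union> {x \<in> ?S. bcl w x = -1}"
    using bcl_cases by auto
  moreover have "card ({x \<in> ?S. bcl w x = 1} \<union> {x \<in> ?S. bcl w x = -1})
      = card {x \<in> ?S. bcl w x = 1} + card {x \<in> ?S. bcl w x = -1}"
    by (rule card_Un_disjoint) (use fin in auto)
  ultimately have "2 * n = 2 * sum_mset (part_of_class ?\<mu> 1) + 2 * sum_mset (part_of_class ?\<mu> (-1))"
    using card_signed_set[of n] sum[of 1] sum[of "-1"] by (simp add: Z2_def)
  then have "sum_mset (fst ?\<mu>) + sum_mset (snd ?\<mu>) = n"
    by (simp add: part_of_class_def)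
  moreover have "0 \<notin># fst ?\<mu>" "0 \<notin># snd ?\<mu>"
    using zero_not_in_cycle_type[OF w, of 1] zero_not_in_cycle_type[OF w, of "-1"]
    by (simp_all add: part_of_class_def Z2_def)
  ultimately show ?thesis by (simp add: bipartitions_def case_prod_unfold)
qed

lemma exists_cycle_type:
  assumes "\<mu> \<in> bipartitions n"
  shows "\<exists>w\<in>B_group n. B_cycle_type n w = \<mu>"
proof -
  have \<mu>: "0 \<notin># part_of_class \<mu> \<theta>" for \<theta>
    using assms by (auto simp: bipartitions_def part_of_class_def)
  have "(\<Sum>\<theta>\<in>Z2. sum_mset (part_of_class \<mu> \<theta>)) = n"
    using assms by (auto simp: bipartitions_def part_of_class_def Z2_def)
  then obtain w where "w \<in> signed_perms (signed_set n)"
      "\<forall>\<theta>\<in>Z2. \<forall>j. class_points (signed_set n) w j \<theta> = 2 * j * count (part_of_class \<mu> \<theta>) j"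
    using exists_class_points[OF sym_set_signed_set card_signed_set, of "part_of_class \<mu>" n] \<mu> by blast
  then show ?thesis using cycle_type_eqI \<mu> unfolding B_group_eq[symmetric] by blast
qed

lemma finite_bipartitions: "finite (bipartitions n)"
proof -
  have "bipartitions n \<subseteq> B_cycle_type n ` B_group n"
    using exists_cycle_type by blast
  then show ?thesis
    using finite_signed_perms[of "signed_set n"] by (auto simp: B_group_eq signed_set_def intro: finite_subset)
qed

text \<open>Points are grouped by class and then by length; the exponent of each indeterminate is
  precisely the number of positive points in its group.\<close>

lemma tmonom_cycle_type:
  assumes w: "w \<in> B_group n"
  shows "tmonom (B_cycle_type n w) = (\<Prod>i\<in>{1..int n}. tvar (blen w i) (bcl w i))"
proof -
  let ?I = "{1..int n}" and ?p = "part_of_class (B_cycle_type n w)"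
  have "(\<Prod>i\<in>?I. tvar (blen w i) (bcl w i))
      = (\<Prod>\<theta>\<in>Z2. \<Prod>i\<in>{i \<in> ?I. bcl w i = \<theta>}. tvar (blen w i) (bcl w i))"
    by (rule prod.group[symmetric]) (use bcl_Z2 in \<open>auto simp: Z2_def\<close>)
  also have "\<dots> = (\<Prod>\<theta>\<in>Z2. \<Prod>j\<in>set_mset (?p \<theta>).
      \<Prod>i\<in>{i \<in> {i \<in> ?I. bcl w i = \<theta>}. blen w i = j}. tvar (blen w i) (bcl w i))"
  proof (intro prod.cong refl prod.group[symmetric])
    fix \<theta> assume \<theta>: "\<theta> \<in> Z2"
    show "blen w ` {i \<in> ?I. bcl w i = \<theta>} \<subseteq> set_mset (?p \<theta>)"
    proof (rule image_subsetI)
      fix i assume "i \<in> {i \<in> ?I. bcl w i = \<theta>}"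
      then have "i \<in> {i' \<in> ?I. blen w i' = blen w i \<and> bcl w i' = \<theta>}" by simp
      then have "0 < card {i' \<in> ?I. blen w i' = blen w i \<and> bcl w i' = \<theta>}"
        by (intro iffD2[OF card_gt_0_iff] conjI) (blast, rule finite_subset[of _ ?I], auto)
      then have "count (?p \<theta>) (blen w i) \<noteq> 0"
        unfolding card_pos_class_points[OF w \<theta>] by simp
      then show "blen w i \<in># ?p \<theta>" by (metis not_in_iff)
    qed
  qed (auto intro: finite_subset[of _ ?I])
  also have "\<dots> = (\<Prod>\<theta>\<in>Z2. \<Prod>j\<in>set_mset (?p \<theta>).
      \<Prod>i\<in>{i \<in> ?I. blen w i = j \<and> bcl w i = \<theta>}. tvar j \<theta>)"
    by (intro prod.cong refl) auto
  also have "\<dots> = tmonom (B_cycle_type n w)"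
    unfolding tmonom_def by (intro prod.cong refl) (simp only: prod_constant card_pos_class_points[OF w])
  finally show ?thesis ..
qed

section \<open>Conjugation, class functions and orbit counting\<close>

definition conj_by :: "(int \<Rightarrow> int) \<Rightarrow> (int \<Rightarrow> int) \<Rightarrow> int \<Rightarrow> int" where
  "conj_by g y = g \<circ> y \<circ> inv g"

lemma B_group_bij: "g \<in> B_group n \<Longrightarrow> bij g"
  by (auto simp: B_group_def intro: permutes_bij)

lemma B_group_comp_inv:
  assumes "g \<in> B_group n"
  shows "g \<circ> inv g = id" "inv g \<circ> g = id"
  using B_group_bij[OF assms] by (meson bij_is_surj surj_iff, meson bij_is_inj inj_iff)

lemma B_group_closed:
  "g \<in> B_group n \<Longrightarrow> h \<in> B_group n \<Longrightarrow> g \<circ> h \<in> B_group n"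
  "g \<in> B_group n \<Longrightarrow> inv g \<in> B_group n"
  "g \<in> B_group n \<Longrightarrow> g ^^ k \<in> B_group n"
  by (auto simp: B_group_eq intro: signed_perms_comp signed_perms_inv signed_perms_funpow)

lemma conj_by_in: "g \<in> B_group n \<Longrightarrow> y \<in> B_group n \<Longrightarrow> conj_by g y \<in> B_group n"
  by (simp add: conj_by_def B_group_closed)

lemma conj_by_eq_iff:
  assumes "g \<in> B_group n"
  shows "conj_by g y = z \<longleftrightarrow> g \<circ> y = z \<circ> g"
  unfolding conj_by_def
  by (metis B_group_comp_inv[OF assms] comp_assoc comp_id)

lemma conj_by_inverse:
  assumes "g \<in> B_group n"
  shows "conj_by (inv g) (conj_by g y) = y" "conj_by g (conj_by (inv g) y) = y"
proof -
  have [simp]: "inv (inv g) = g" using B_group_bij[OF assms] by (rule inv_inv_eq)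
  show "conj_by (inv g) (conj_by g y) = y" "conj_by g (conj_by (inv g) y) = y"
    unfolding conj_by_def \<open>inv (inv g) = g\<close>
    by (metis B_group_comp_inv[OF assms] comp_assoc comp_id id_comp)+
qed

lemma conj_by_funpow:
  assumes "g \<in> B_group n"
  shows "conj_by g x ^^ k = conj_by g (x ^^ k)"
proof (induction k)
  case 0
  show ?case
    unfolding conj_by_def by (metis B_group_comp_inv(1)[OF assms] comp_id funpow.simps(1))
next
  case (Suc k)
  have "conj_by g x ^^ Suc k = conj_by g x \<circ> conj_by g (x ^^ k)"
    by (simp add: Suc)
  also have "\<dots> = g \<circ> x \<circ> (inv g \<circ> g) \<circ> (x ^^ k) \<circ> inv g"
    by (simp add: conj_by_def comp_assoc)
  also have "\<dots> = conj_by g (x ^^ Suc k)"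
    by (simp add: B_group_comp_inv[OF assms] conj_by_def comp_assoc)
  finally show ?case .
qed

lemma class_points_conj:
  assumes g: "g \<in> B_group n" and y: "y \<in> B_group n"
  shows "class_points (signed_set n) (conj_by g y) j \<theta> = class_points (signed_set n) y j \<theta>"
proof -
  have gp: "g permutes signed_set n" "\<And>i. g (- i) = - g i" using g by (auto simp: B_group_def)
  have inj: "g a = g b \<longleftrightarrow> a = b" for a b using permutes_inj[OF gp(1)] by (auto dest: injD)
  have pow: "(conj_by g y ^^ t) (g x) = g ((y ^^ t) x)" for t x
    unfolding conj_by_funpow[OF g] by (simp add: conj_by_def permutes_inverses[OF gp(1)])
  have blen: "blen (conj_by g y) (g x) = blen y x" for x
    by (simp add: blen_def pow gp(2)[symmetric] inj)
  have bcl: "bcl (conj_by g y) (g x) = bcl y x" for x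
    by (simp add: bcl_def blen pow inj)
  have "{x \<in> signed_set n. blen (conj_by g y) x = j \<and> bcl (conj_by g y) x = \<theta>}
      = g ` {x \<in> signed_set n. blen y x = j \<and> bcl y x = \<theta>}"
  proof (intro set_eqI iffI)
    fix x assume x: "x \<in> {x \<in> signed_set n. blen (conj_by g y) x = j \<and> bcl (conj_by g y) x = \<theta>}"
    obtain x' where "x' \<in> signed_set n" "x = g x'"
      using x permutes_image[OF gp(1)] by auto
    with x show "x \<in> g ` {x \<in> signed_set n. blen y x = j \<and> bcl y x = \<theta>}"
      by (simp add: blen bcl)
  qed (use permutes_in_image[OF gp(1)] blen bcl in auto)
  then show ?thesis
    using permutes_inj[OF gp(1)] by (simp add: class_points_def card_image inj_on_def inj)
qed

lemma cycle_type_conj: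
  assumes g: "g \<in> B_group n" and y: "y \<in> B_group n"
  shows "B_cycle_type n (conj_by g y) = B_cycle_type n y"
  by (rule cycle_type_eqI[OF conj_by_in[OF assms]])
    (simp_all only: zero_not_in_cycle_type[OF y] class_points_conj[OF assms] class_points_cycle_type[OF y] not_False_eq_True)

lemma same_cycle_type_conj:
  assumes y: "y \<in> B_group n" and z: "z \<in> B_group n" and eq: "B_cycle_type n y = B_cycle_type n z"
  shows "\<exists>g\<in>B_group n. conj_by g y = z"
proof -
  let ?S = "signed_set n"
  have "class_points ?S y j \<theta> = class_points ?S z j \<theta>" for j \<theta>
  proof (cases "\<theta> \<in> Z2")
    case True
    then show ?thesis by (simp add: class_points_cycle_type y z eq)
  next
    \<comment> \<open>Outside \<open>Z2\<close> both counts vanish, since \<open>bcl\<close> takes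
      only the values 1 and -1.\<close>
    case False
    then have "bcl w x \<noteq> \<theta>" for w x using bcl_Z2 by metis
    then show ?thesis by (simp add: class_points_def)
  qed
  then obtain \<phi> where \<phi>: "\<And>x. \<phi> (- x) = - \<phi> x" "bij_betw \<phi> ?S ?S" "\<And>x. x \<in> ?S \<Longrightarrow> \<phi> (y x) = z (\<phi> x)"
    using equal_class_points_conjugate[OF sym_set_signed_set sym_set_signed_set, of y n z n] y z
    unfolding B_group_eq by metis
  \<comment> \<open>The conjugator is controlled only on the signed set; elements of the group must
    be the identity elsewhere.\<close>
  define g where "g x = (if x \<in> ?S then \<phi> x else x)" for x
  have "bij_betw g ?S ?S"
    using \<phi>(2) by (subst bij_betw_cong[of _ _ \<phi>]) (auto simp: g_def)
  then have "g permutes ?S" by (rule bij_imp_permutes) (simp add: g_def)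
  moreover have "- x \<in> ?S \<longleftrightarrow> x \<in> ?S" for x by (auto simp: signed_set_def)
  ultimately have g: "g \<in> B_group n" using \<phi>(1) by (simp add: B_group_def g_def)
  have yz: "y permutes ?S" "z permutes ?S" using y z by (auto simp: B_group_def)
  have "g (y x) = z (g x)" for x
  proof (cases "x \<in> ?S")
    case True
    then show ?thesis using \<phi>(3) permutes_in_image[OF yz(1)] by (simp add: g_def)
  next
    case False
    then show ?thesis using permutes_not_in[OF yz(1)] permutes_not_in[OF yz(2)] by (simp add: g_def)
  qed
  then have "conj_by g y = z" unfolding conj_by_eq_iff[OF g] by (simp add: fun_eq_iff)
  with g show ?thesis by blast
qed

text \<open>By oddness the sign of u(v i) is the sign of u at the absolute value of v i times the
  sign of v i, and taking absolute values of v permutes 1, ..., n.\<close>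

lemma B_chi_comp:
  assumes u: "u \<in> B_group n" and v: "v \<in> B_group n"
  shows "B_chi n (u \<circ> v) = B_chi n u * B_chi n v"
proof -
  let ?I = "{1..int n}"
  have vp: "v permutes signed_set n" "\<And>i. v (- i) = - v i" using v by (auto simp: B_group_def)
  have up: "\<And>i. u (- i) = - u i" using u by (auto simp: B_group_def)
  have v_in: "\<bar>v i\<bar> \<in> ?I" if "i \<in> ?I" for i
  proof -
    have "v i \<in> signed_set n"
      using permutes_in_image[OF vp(1), of i] that by (simp add: signed_set_def)
    then show ?thesis by (auto simp: signed_set_def)
  qed
  have "inj_on (\<lambda>i. \<bar>v i\<bar>) ?I"
  proof (rule inj_onI)
    fix i j assume ij: "i \<in> ?I" "j \<in> ?I" "\<bar>v i\<bar> = \<bar>v j\<bar>"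
    then have "v i = v j \<or> v i = v (- j)" by (simp add: vp(2) abs_eq_iff)
    then have "i = j \<or> i = - j" using permutes_inj[OF vp(1)] by (auto dest: injD)
    then show "i = j" using ij by auto
  qed
  then have bij: "bij_betw (\<lambda>i. \<bar>v i\<bar>) ?I ?I"
    using v_in by (intro bij_betw_imageI endo_inj_surj) auto
  have "B_chi n (u \<circ> v) = (\<Prod>i\<in>?I. sgn (u \<bar>v i\<bar>) * sgn (v i))"
    unfolding B_chi_def
  proof (rule prod.cong)
    fix i assume "i \<in> ?I"
    then have "v i \<noteq> 0" using v_in[of i] by auto
    then show "sgn ((u \<circ> v) i) = sgn (u \<bar>v i\<bar>) * sgn (v i)"
      using up[of "v i"] by (cases "v i > 0") (auto simp: abs_if)
  qed simp
  also have "\<dots> = (\<Prod>i\<in>?I. sgn (u \<bar>v i\<bar>)) * B_chi n v"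
    by (simp add: prod.distrib B_chi_def)
  also have "(\<Prod>i\<in>?I. sgn (u \<bar>v i\<bar>)) = B_chi n u"
    unfolding B_chi_def by (rule prod.reindex_bij_betw[OF bij])
  finally show ?thesis .
qed

lemma B_chi_conj:
  assumes g: "g \<in> B_group n" and x: "x \<in> B_group n"
  shows "B_chi n (conj_by g x) = B_chi n x"
proof -
  have "B_chi n g * B_chi n (inv g) = B_chi n id"
    by (simp add: B_chi_comp[symmetric] g B_group_closed B_group_comp_inv[OF g])
  also have "\<dots> = 1" unfolding B_chi_def by (rule prod.neutral) auto
  finally show ?thesis
    using g x by (simp add: conj_by_def B_chi_comp B_group_closed)
qed

text \<open>Conjugation carries the k-th roots of y to those of its conjugate and preserves the
  character. The chosen representative of a class therefore gives the value at every element of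
  it.\<close>

lemma B_sroots_conj:
  assumes g: "g \<in> B_group n"
  shows "B_sroots k n (conj_by g y) = B_sroots k n y"
proof -
  have g': "inv g \<in> B_group n" using g by (rule B_group_closed)
  show ?thesis
    unfolding B_sroots_def
    by (rule sum.reindex_bij_witness[of _ "conj_by g" "conj_by (inv g)"])
      (use conj_by_inverse[OF g] in
        \<open>auto simp: conj_by_in g g' B_chi_conj conj_by_funpow[OF g] conj_by_funpow[OF g']\<close>)
qed

text \<open>The map sending g to the conjugate of y by g has the class as its image and left cosets
  of the centralizer as its fibres; each fibre is nonempty because equal cycle types are
  conjugate.\<close>

lemma orbit_stabilizer:
  assumes y: "y \<in> B_group n"
  shows "card {z \<in> B_group n. B_cycle_type n z = B_cycle_type n y} * card (B_centralizer n y) = card (B_group n)"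
proof -
  let ?cls = "{z \<in> B_group n. B_cycle_type n z = B_cycle_type n y}"
  have fin: "finite (B_group n)"
    by (simp add: B_group_eq finite_signed_perms signed_set_def)
  have "card {g \<in> B_group n. conj_by g y = z} = card (B_centralizer n y)" if z: "z \<in> ?cls" for z
  proof -
    obtain h where h: "h \<in> B_group n" "conj_by h y = z"
      using same_cycle_type_conj[OF y, of z] z by auto
    have "bij_betw (\<lambda>x. h \<circ> x) (B_centralizer n y) {g \<in> B_group n. conj_by g y = z}"
    proof (rule bij_betw_byWitness[where f' = "\<lambda>g. inv h \<circ> g"])
      show "\<forall>x\<in>B_centralizer n y. inv h \<circ> (h \<circ> x) = x"
        by (metis B_group_comp_inv(2)[OF h(1)] comp_assoc id_comp)
      show "\<forall>g\<in>{g \<in> B_group n. conj_by g y = z}. h \<circ> (inv h \<circ> g) = g"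
        by (metis B_group_comp_inv(1)[OF h(1)] comp_assoc id_comp)
      have hz: "h \<circ> y = z \<circ> h" using h conj_by_eq_iff by blast
      show "(\<lambda>x. h \<circ> x) ` B_centralizer n y \<subseteq> {g \<in> B_group n. conj_by g y = z}"
      proof (rule image_subsetI)
        fix x assume x: "x \<in> B_centralizer n y"
        then have hx: "h \<circ> x \<in> B_group n" using h by (auto simp: B_centralizer_def B_group_closed)
        have "(h \<circ> x) \<circ> y = z \<circ> (h \<circ> x)"
          using x hz by (simp add: B_centralizer_def comp_assoc) (metis comp_assoc)
        with hx show "h \<circ> x \<in> {g \<in> B_group n. conj_by g y = z}"
          using conj_by_eq_iff[OF hx] by simp
      qed
      show "(\<lambda>g. inv h \<circ> g) ` {g \<in> B_group n. conj_by g y = z} \<subseteq> B_centralizer n y"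
      proof (rule image_subsetI)
        fix g assume g: "g \<in> {g \<in> B_group n. conj_by g y = z}"
        then have gz: "g \<circ> y = z \<circ> g" using conj_by_eq_iff by blast
        have "inv h \<circ> z = y \<circ> inv h"
          using hz by (metis B_group_comp_inv[OF h(1)] comp_assoc comp_id id_comp)
        then have "(inv h \<circ> g) \<circ> y = y \<circ> (inv h \<circ> g)" using gz by (metis comp_assoc)
        then show "inv h \<circ> g \<in> B_centralizer n y"
          using g h by (simp add: B_centralizer_def B_group_closed)
      qed
    qed
    then show ?thesis by (metis bij_betw_same_card)
  qed
  then have "(\<Sum>z\<in>?cls. card {g \<in> B_group n. conj_by g y = z}) = card ?cls * card (B_centralizer n y)"
    by simp
  moreover have "(\<Sum>z\<in>?cls. \<Sum>g\<in>{g \<in> B_group n. conj_by g y = z}. 1) = (\<Sum>g\<in>B_group n. 1::nat)"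
    by (rule sum.group) (use fin y in \<open>auto simp: conj_by_in cycle_type_conj\<close>)
  ultimately show ?thesis by simp
qed

definition root_weight :: "nat \<Rightarrow> nat \<Rightarrow> int \<Rightarrow> tseries" where
  "root_weight k l \<epsilon> = tvar (l div gcd l k) (\<epsilon> ^ (k div gcd l k))"

lemma cycle_weight_root_weight:
  assumes x: "x \<in> B_group n"
  shows "cycle_weight 1 (root_weight k) (signed_set n) x
    = of_int (B_chi n x) * tmonom (B_cycle_type n (x ^^ k))"
proof -
  interpret signed_perm "signed_set n" x
    by unfold_locales (use x in \<open>auto simp: B_group_eq\<close>)
  have "cycle_weight 1 (root_weight k) (signed_set n) x
      = (\<Prod>i\<in>{1..int n}. of_int (sgn (x i)) * tvar (blen (x ^^ k) i) (bcl (x ^^ k) i))"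
    unfolding cycle_weight_def pos_part_signed_set
    by (rule prod.cong) (auto simp: root_weight_def blen_funpow bcl_funpow signed_set_def)
  then show ?thesis
    by (simp add: prod.distrib B_chi_def tmonom_cycle_type[OF B_group_closed(3)[OF x]])
qed

text \<open>The elements x are sorted by the cycle type of their k-th power and then by the power
  itself. All elements of a class contribute the same root sum, and the class size divided by the
  group order is the reciprocal of the centralizer order.\<close>

lemma class_sum_eq_weight_sum:
  "(\<Sum>\<mu>\<in>bipartitions n.
      mfps_const (of_int (B_class_sroots k n \<mu>) / of_nat (B_class_centralizer_order n \<mu>)) * tmonom \<mu>)
    = mfps_const (1 / of_nat (2 ^ n * fact n)) * weight_sum 1 (root_weight k) (signed_set n)"
proof -
  let ?B = "B_group n"
  let ?fib = "\<lambda>\<mu>. {x \<in> ?B. B_cycle_type n (x ^^ k) = \<mu>}"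
  have fin: "finite ?B"
    by (simp add: B_group_eq finite_signed_perms signed_set_def)
  have coeff: "mfps_const (1 / of_nat (card ?B)) * of_int (\<Sum>x\<in>?fib \<mu>. B_chi n x)
      = (mfps_const (of_int (B_class_sroots k n \<mu>) / of_nat (B_class_centralizer_order n \<mu>)) :: tseries)"
    if \<mu>: "\<mu> \<in> bipartitions n" for \<mu>
  proof -
    define y where "y = B_class_elem n \<mu>"
    have y: "y \<in> ?B" "B_cycle_type n y = \<mu>"
      using someI_ex[of "\<lambda>y. y \<in> ?B \<and> B_cycle_type n y = \<mu>"] exists_cycle_type[OF \<mu>]
      unfolding y_def B_class_elem_def by blast+
    let ?cls = "{z \<in> ?B. B_cycle_type n z = \<mu>}"
    have "(\<Sum>x\<in>?fib \<mu>. B_chi n x) = (\<Sum>z\<in>?cls. \<Sum>x\<in>{x \<in> ?fib \<mu>. x ^^ k = z}. B_chi n x)"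
      by (rule sum.group[symmetric]) (use fin in \<open>auto simp: B_group_closed\<close>)
    also have "\<dots> = (\<Sum>z\<in>?cls. B_sroots k n z)"
      unfolding B_sroots_def by (intro sum.cong refl) auto
    also have "\<dots> = (\<Sum>z\<in>?cls. B_class_sroots k n \<mu>)"
    proof (rule sum.cong)
      fix z assume "z \<in> ?cls"
      then obtain g where "g \<in> ?B" "conj_by g y = z"
        using same_cycle_type_conj[OF y(1), of z] y(2) by auto
      then show "B_sroots k n z = B_class_sroots k n \<mu>"
        using B_sroots_conj by (auto simp: B_class_sroots_def y_def)
    qed simp
    finally have sum: "(\<Sum>x\<in>?fib \<mu>. B_chi n x) = int (card ?cls) * B_class_sroots k n \<mu>" by simp
    have card: "card ?cls * B_class_centralizer_order n \<mu> = card ?B"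
      using orbit_stabilizer[OF y(1)] y(2) by (simp add: B_class_centralizer_order_def y_def)
    have "card ?B \<noteq> 0" by (simp add: card_B_group)
    then have "card ?cls \<noteq> 0" "B_class_centralizer_order n \<mu> \<noteq> 0" using card by (metis mult_is_0)+
    then show ?thesis
      unfolding sum card[symmetric] mfps_const_of_int[symmetric] mfps_const_mult[symmetric]
      by (simp add: field_simps)
  qed
  have "weight_sum 1 (root_weight k) (signed_set n)
      = (\<Sum>x\<in>?B. of_int (B_chi n x) * tmonom (B_cycle_type n (x ^^ k)))"
    unfolding weight_sum_def B_group_eq[symmetric] by (intro sum.cong refl cycle_weight_root_weight)
  also have "\<dots> = (\<Sum>\<mu>\<in>bipartitions n. \<Sum>x\<in>?fib \<mu>. of_int (B_chi n x) * tmonom (B_cycle_type n (x ^^ k)))"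
    by (rule sum.group[symmetric])
      (use fin finite_bipartitions in \<open>auto intro!: cycle_type_in_bipartitions B_group_closed\<close>)
  also have "\<dots> = (\<Sum>\<mu>\<in>bipartitions n. of_int (\<Sum>x\<in>?fib \<mu>. B_chi n x) * tmonom \<mu>)"
    by (intro sum.cong refl) (simp add: sum_distrib_right)
  finally have "mfps_const (1 / of_nat (card ?B)) * weight_sum 1 (root_weight k) (signed_set n)
      = (\<Sum>\<mu>\<in>bipartitions n. mfps_const (1 / of_nat (card ?B)) * of_int (\<Sum>x\<in>?fib \<mu>. B_chi n x) * tmonom \<mu>)"
    by (simp only: sum_distrib_left mult.assoc)
  also have "\<dots> = (\<Sum>\<mu>\<in>bipartitions n.
      mfps_const (of_int (B_class_sroots k n \<mu>) / of_nat (B_class_centralizer_order n \<mu>)) * tmonom \<mu>)"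
    by (intro sum.cong refl) (simp only: coeff)
  finally show ?thesis by (simp only: card_B_group)
qed

section \<open>Coefficients of the exponent\<close>

text \<open>The zero series is homogeneous of every degree, so cancellation in sums needs no special
  care.\<close>

definition homogeneous :: "nat \<Rightarrow> ('v, 'a::comm_ring_1) mfps \<Rightarrow> bool" where
  "homogeneous n F \<longleftrightarrow> (\<forall>m. mfps_nth F m \<noteq> 0 \<longrightarrow> mdeg m = n)"

lemma homogeneous_nth: "homogeneous n F \<Longrightarrow> mdeg m \<noteq> n \<Longrightarrow> mfps_nth F m = 0"
  by (auto simp: homogeneous_def)

lemma homogeneous_sum: "(\<And>i. i \<in> A \<Longrightarrow> homogeneous n (f i)) \<Longrightarrow> homogeneous n (sum f A)"
  unfolding homogeneous_def mfps_nth_sum using sum.not_neutral_contains_not_neutral by metis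

lemma homogeneous_const_mult: "homogeneous n F \<Longrightarrow> homogeneous n (mfps_const c * F)"
  unfolding homogeneous_def by (metis mfps_nth_const_mult mult_zero_right)

lemma homogeneous_of_int_mult: "homogeneous n F \<Longrightarrow> homogeneous n (of_int c * F)"
  by (simp add: homogeneous_const_mult flip: mfps_const_of_int)

lemma homogeneous_var_power: "homogeneous n (mfps_var v ^ n)"
  by (simp add: homogeneous_def mfps_nth_var_power)

lemma homogeneous_mult:
  assumes "homogeneous p F" "homogeneous q G"
  shows "homogeneous (p + q) (F * G)"
  unfolding homogeneous_def
proof (intro allI impI)
  fix m assume "mfps_nth (F * G) m \<noteq> 0"
  then obtain ab where "ab \<in> splittings m" "(case ab of (a, b) \<Rightarrow> mfps_nth F a * mfps_nth G b) \<noteq> 0"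
    unfolding mfps_nth_mult by (meson sum.not_neutral_contains_not_neutral)
  then obtain a b where "a + b = m" "mfps_nth F a * mfps_nth G b \<noteq> 0"
    by (auto simp: splittings_def)
  with assms show "mdeg m = p + q"
    unfolding homogeneous_def by (metis mdeg_add mult_zero_left mult_zero_right)
qed

lemma homogeneous_prod:
  "finite A \<Longrightarrow> (\<And>i. i \<in> A \<Longrightarrow> homogeneous 1 (f i)) \<Longrightarrow> homogeneous (card A) (prod f A)"
proof (induction rule: finite_induct)
  case empty
  show ?case by (auto simp: homogeneous_def mfps_nth_1)
next
  case (insert x A)
  then show ?case using homogeneous_mult[of 1 "f x" "card A" "prod f A"] by simp
qed

lemma homogeneous_weight_sum: "homogeneous n (weight_sum e (root_weight k) (signed_set n))"
proof -
  have "homogeneous 1 (root_weight k l \<epsilon>)" for l \<epsilon>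
    unfolding root_weight_def tvar_def using homogeneous_var_power[of 1] by simp
  then have "homogeneous (card {1..int n}) (cycle_weight e (root_weight k) (signed_set n) w)" for w
    unfolding cycle_weight_def pos_part_signed_set
    by (intro homogeneous_prod homogeneous_of_int_mult) auto
  then show ?thesis
    unfolding weight_sum_def by (intro homogeneous_sum) simp
qed

section \<open>The averages and the cycle terms of the recursion\<close>

definition group_average :: "nat \<Rightarrow> nat \<Rightarrow> tseries" where
  "group_average k n = mfps_const (1 / of_nat (2 ^ n * fact n)) * weight_sum 1 (root_weight k) (signed_set n)"

definition cycle_term :: "nat \<Rightarrow> nat \<Rightarrow> tseries" where
  "cycle_term k l = mfps_const (1 / 2) * (\<Sum>\<epsilon>\<in>Z2. of_int \<epsilon> * root_weight k l \<epsilon> ^ l)"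

lemma homogeneous_group_average: "homogeneous n (group_average k n)"
  unfolding group_average_def by (intro homogeneous_const_mult homogeneous_weight_sum)

lemma homogeneous_cycle_term: "homogeneous l (cycle_term k l)"
  unfolding cycle_term_def root_weight_def tvar_def
  by (intro homogeneous_const_mult homogeneous_sum homogeneous_of_int_mult homogeneous_var_power)

lemma group_average_0: "group_average k 0 = 1"
  by (rule mfps_eqI) (simp add: group_average_def mfps_nth_const mfps_nth_1)

text \<open>The number 2^(l-1) (n-1)! / (n-l)! of possible cycles, multiplied by n / (2^n n!), is
  one half of 1 / (2^(n-l) (n-l)!). This is the origin of the factor 1/2 in
  \<open>cycle_term\<close>.\<close>

lemma group_average_rec:
  "mfps_const (of_nat n) * group_average k n = (\<Sum>l = 1..n. cycle_term k l * group_average k (n - l))"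
proof (cases "n = 0")
  case True
  then show ?thesis by (intro mfps_eqI) simp
next
  case False
  let ?W = "\<lambda>n. weight_sum 1 (root_weight k) (signed_set n)"
    and ?V = "\<lambda>l. \<Sum>\<epsilon>\<in>Z2. of_int \<epsilon> * root_weight k l \<epsilon> ^ l"
  let ?c = "\<lambda>n. 1 / of_nat (2 ^ n * fact n) :: complex"
  have W: "?W n = (\<Sum>l = 1..n. mfps_const (of_nat (cycle_count n l)) * (?V l * ?W (n - l)))"
    using weight_sum_rec[of n 1 "root_weight k"] False by (simp add: mfps_const_of_nat)
  have coeff: "of_nat n * ?c n * of_nat (cycle_count n l) = 1 / 2 * ?c (n - l)" if l: "l \<in> {1..n}" for l
  proof -
    \<comment> \<open>The identity is first cleared of denominators in the natural numbers, where
      \<open>cycle_count_fact\<close> applies, and then cast.\<close>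
    have "2 * n * cycle_count n l * (2 ^ (n - l) * fact (n - l))
        = 2 ^ (n - l) * 2 * n * (cycle_count n l * fact (n - l))"
      by (simp only: ac_simps)
    also have "\<dots> = (2 ^ (n - l) * (2 * 2 ^ (l - 1))) * (n * fact (n - 1))"
      using l by (simp only: cycle_count_fact atLeastAtMost_iff ac_simps)
    also have "2 ^ (n - l) * (2 * 2 ^ (l - 1)) = (2 ^ n :: nat)"
      using l by (simp add: power_add[symmetric] power_Suc[symmetric] del: power_Suc)
    also have "n * fact (n - 1) = fact n" using False by (simp add: fact_reduce)
    finally have "of_nat (2 * n * cycle_count n l * (2 ^ (n - l) * fact (n - l)))
      = (of_nat (2 ^ n * fact n) :: complex)" by (rule arg_cong)
    then show ?thesis by (simp add: field_simps)
  qed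
  have "mfps_const (of_nat n) * group_average k n
      = (\<Sum>l = 1..n. mfps_const (of_nat n * ?c n * of_nat (cycle_count n l)) * (?V l * ?W (n - l)))"
    unfolding group_average_def W by (simp only: sum_distrib_left mfps_const_mult mult.assoc)
  also have "\<dots> = (\<Sum>l = 1..n. mfps_const (1 / 2 * ?c (n - l)) * (?V l * ?W (n - l)))"
    by (intro sum.cong refl) (simp only: coeff)
  also have "\<dots> = (\<Sum>l = 1..n. cycle_term k l * group_average k (n - l))"
    unfolding cycle_term_def group_average_def by (simp only: mfps_const_mult ac_simps)
  finally show ?thesis .
qed

text \<open>Grouping the classes \<epsilon> by their power \<epsilon>^h converts between the sum
  over \<theta> in the theorem and the sum over classes of cycles in the recursion.\<close>

lemma Z2_sroots_sum:
  fixes X :: "int \<Rightarrow> complex"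
  shows "(\<Sum>\<theta>\<in>Z2. of_int (Z2_sroots h \<theta>) * X \<theta>) = (\<Sum>\<epsilon>\<in>Z2. of_int \<epsilon> * X (\<epsilon> ^ h))"
proof -
  have fin: "finite Z2" by (simp add: Z2_def)
  have img: "(\<lambda>\<epsilon>. \<epsilon> ^ h) ` Z2 \<subseteq> Z2"
    by (cases "even h") (auto simp: Z2_def)
  have "(\<Sum>\<epsilon>\<in>Z2. of_int \<epsilon> * X (\<epsilon> ^ h))
      = (\<Sum>\<theta>\<in>Z2. \<Sum>\<epsilon>\<in>{\<epsilon> \<in> Z2. \<epsilon> ^ h = \<theta>}. of_int \<epsilon> * X (\<epsilon> ^ h))"
    by (rule sum.group[symmetric]) (use fin img in auto)
  also have "\<dots> = (\<Sum>\<theta>\<in>Z2. of_int (Z2_sroots h \<theta>) * X \<theta>)"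
    unfolding Z2_sroots_def by (intro sum.cong refl) (simp add: sum_distrib_right)
  finally show ?thesis ..
qed

text \<open>
  The index pairs \<open>(j, h)\<close> of the exponent correspond to cycle lengths \<open>l\<close>: the \<open>k\<close>-th power of an
  \<open>l\<close>-cycle consists of \<open>gcd l k = k / h\<close> cycles of length \<open>j\<close>.
\<close>

lemma coprime_divisor_iff:
  fixes j h k l :: nat
  assumes "0 < k" "0 < l"
  shows "h dvd k \<and> gcd h j = 1 \<and> j * (k div h) = l \<longleftrightarrow> j = l div gcd l k \<and> h = k div gcd l k"
proof
  assume *: "h dvd k \<and> gcd h j = 1 \<and> j * (k div h) = l"
  then have k: "k = h * (k div h)" by simp
  have "gcd l k = gcd (j * (k div h)) (h * (k div h))" using * k by metis
  also have "\<dots> = gcd j h * (k div h)" by (metis gcd_mult_distrib_nat mult.commute)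
  also have "\<dots> = k div h" using * by (simp add: gcd.commute)
  finally have g: "gcd l k = k div h" .
  have pos: "0 < k div h" using assms(1) k by (metis mult_0_right neq0_conv)
  have "l div (k div h) = j" using * pos by (metis nonzero_mult_div_cancel_right neq0_conv)
  moreover have "k div (k div h) = h" using k pos by (metis nonzero_mult_div_cancel_right neq0_conv)
  ultimately show "j = l div gcd l k \<and> h = k div gcd l k" by (simp add: g)
next
  assume *: "j = l div gcd l k \<and> h = k div gcd l k"
  define g where "g = gcd l k"
  have g: "0 < g" "l = j * g" "k = h * g" using * assms by (auto simp: g_def)
  have "0 < h" using g(3) assms(1) by (cases h) auto
  then have "k div h = g" using g(3) by simp
  moreover have "coprime h j"
    using * div_gcd_coprime[of l k] assms by (auto simp: coprime_commute)
  ultimately show "h dvd k \<and> gcd h j = 1 \<and> j * (k div h) = l"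
    using g by (simp add: coprime_iff_gcd_eq_1)
qed

definition root_exponent :: "nat \<Rightarrow> nat \<Rightarrow> tseries" where
  "root_exponent k j = (\<Sum>\<theta>\<in>Z2. \<Sum>h | h dvd k \<and> gcd h j = 1.
     mfps_const (of_int (Z2_sroots h \<theta>) / of_nat (2 * j * (k div h))) * tvar j \<theta> ^ (j * (k div h)))"

lemma nth_tvar_power:
  "mfps_nth (tvar j \<theta> ^ n) a = (if a = Poly_Mapping.single (j, \<theta>) n then 1 else 0)"
  by (simp add: tvar_def mfps_nth_var_power)

text \<open>A monomial of degree l meets only pairs (j, h) with j (k/h) = l, and there is just one
  such pair. The denominator is then 2 l, so the Euler factor l leaves the 1/2 of
  \<open>cycle_term\<close>.\<close>

lemma nth_root_exponent:
  assumes k: "0 < k" and a: "a \<noteq> 0" and j: "1 \<le> j"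
  shows "of_nat (mdeg a) * mfps_nth (root_exponent k j) a
    = (if j = mdeg a div gcd (mdeg a) k then mfps_nth (cycle_term k (mdeg a)) a else 0)"
proof -
  let ?l = "mdeg a"
  let ?h = "k div gcd ?l k"
  let ?H = "{h. h dvd k \<and> gcd h j = 1}"
  let ?q = "\<lambda>\<theta> h. of_int (Z2_sroots h \<theta>) / of_nat (2 * j * (k div h))
      * mfps_nth (tvar j \<theta> ^ (j * (k div h))) a"
  have l: "0 < ?l" using a mdeg_eq_0_iff by blast
  have finH: "finite ?H" using k by (auto intro: finite_subset[OF _ finite_divisors_nat])
  have nth: "mfps_nth (root_exponent k j) a = (\<Sum>\<theta>\<in>Z2. \<Sum>h\<in>?H. ?q \<theta> h)"
    by (simp add: root_exponent_def mfps_nth_sum)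
  have zero: "?q \<theta> h = 0" if "j * (k div h) \<noteq> ?l" for \<theta> h
    using that by (auto simp: nth_tvar_power)
  show ?thesis
  proof (cases "j = ?l div gcd ?l k")
    case False
    then have ne: "j * (k div h) \<noteq> ?l" if "h \<in> ?H" for h
      using coprime_divisor_iff[OF k l, of h j] that by blast
    have "(\<Sum>\<theta>\<in>Z2. \<Sum>h\<in>?H. ?q \<theta> h) = 0"
    proof (rule sum.neutral, rule ballI, rule sum.neutral, rule ballI)
      show "?q \<theta> h = 0" if "h \<in> ?H" for \<theta> h
        by (rule zero, rule ne) (rule that)
    qed
    then show ?thesis using False by (simp only: nth if_False mult_zero_right)
  next
    case True
    have h: "?h \<in> ?H" "j * (k div ?h) = ?l"
      using coprime_divisor_iff[OF k l, of ?h j] True by auto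
    have "(\<Sum>h\<in>?H. ?q \<theta> h) = (\<Sum>h\<in>{?h}. ?q \<theta> h)" for \<theta>
    proof (rule sum.mono_neutral_right[OF finH])
      show "\<forall>h\<in>?H - {?h}. ?q \<theta> h = 0"
      proof
        fix h assume "h \<in> ?H - {?h}"
        then have "j * (k div h) \<noteq> ?l" using coprime_divisor_iff[OF k l, of h j] by auto
        then show "?q \<theta> h = 0" by (rule zero)
      qed
    qed (use h in simp)
    then have "of_nat ?l * mfps_nth (root_exponent k j) a = (\<Sum>\<theta>\<in>Z2. of_nat ?l * ?q \<theta> ?h)"
      by (simp add: nth sum_distrib_left)
    also have "\<dots> = (\<Sum>\<theta>\<in>Z2. of_int (Z2_sroots ?h \<theta>) * (1 / 2 * mfps_nth (tvar j \<theta> ^ ?l) a))"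
    proof (rule sum.cong)
      fix \<theta>
      have "(of_nat (2 * j * (k div ?h)) :: complex) = 2 * of_nat ?l"
        using h(2) by (metis mult.assoc of_nat_mult of_nat_numeral)
      then show "of_nat ?l * ?q \<theta> ?h = of_int (Z2_sroots ?h \<theta>) * (1 / 2 * mfps_nth (tvar j \<theta> ^ ?l) a)"
        using a by (simp only: h(2)) (simp add: field_simps)
    qed simp
    also have "\<dots> = (\<Sum>\<epsilon>\<in>Z2. of_int \<epsilon> * (1 / 2 * mfps_nth (tvar j (\<epsilon> ^ ?h) ^ ?l) a))"
      by (rule Z2_sroots_sum)
    also have "\<dots> = mfps_nth (cycle_term k ?l) a"
      unfolding cycle_term_def root_weight_def True[symmetric] mfps_const_of_int[symmetric]
      by (simp add: mfps_nth_sum sum_distrib_left ac_simps)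
    finally show ?thesis using True by simp
  qed
qed

lemma nth_root_exponent_0:
  assumes "0 < k" "1 \<le> j"
  shows "mfps_nth (root_exponent k j) 0 = 0"
proof -
  have "mfps_nth (tvar j \<theta> ^ (j * (k div h))) 0 = 0" if "h dvd k" for h \<theta>
  proof -
    have "j * (k div h) \<noteq> 0" using that assms by (auto elim!: dvdE)
    then show ?thesis by (subst nth_tvar_power) (metis mdeg_0 mdeg_single)
  qed
  then show ?thesis by (simp add: root_exponent_def mfps_nth_sum)
qed

text \<open>Each coefficient is affected by at most one j, so the infinite sum converges and can be
  read off coefficientwise. The constant term is treated apart: it must vanish for the exponential,
  and the Euler operator cannot see it.\<close>

lemma euler_exponent:
  assumes k: "0 < k"
  shows "mfps_nth (\<Sum>\<^sub>\<infinity>j\<in>{1..}. root_exponent k j) 0 = 0"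
    and "a \<noteq> 0 \<Longrightarrow> of_nat (mdeg a) * mfps_nth (\<Sum>\<^sub>\<infinity>j\<in>{1..}. root_exponent k j) a
      = mfps_nth (cycle_term k (mdeg a)) a"
proof -
  let ?N = "\<lambda>a. {j \<in> {1..}. mfps_nth (root_exponent k j) a \<noteq> 0}"
  let ?j = "\<lambda>a. mdeg a div gcd (mdeg a) k"
  have sub: "?N a \<subseteq> {?j a}" if a: "a \<noteq> 0" for a
  proof
    fix j assume j: "j \<in> ?N a"
    have "mdeg a \<noteq> 0" using a by simp
    then have "of_nat (mdeg a) * mfps_nth (root_exponent k j) a \<noteq> 0" using j by simp
    then show "j \<in> {?j a}" using nth_root_exponent[OF k a, of j] j by (auto split: if_splits)
  qed
  have empty: "?N 0 = {}" using nth_root_exponent_0[OF k] by auto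
  have "finite (?N a)" for a
    using sub[of a] empty finite_subset[of "?N a" "{?j a}"] by (cases "a = 0") auto
  then have "(root_exponent k has_sum Abs_mfps (\<lambda>a. \<Sum>j\<in>?N a. mfps_nth (root_exponent k j) a)) {1..}"
    by (rule has_sum_mfps)
  then have nth: "mfps_nth (\<Sum>\<^sub>\<infinity>j\<in>{1..}. root_exponent k j) a = (\<Sum>j\<in>?N a. mfps_nth (root_exponent k j) a)" for a
    by (simp add: infsumI)
  show "mfps_nth (\<Sum>\<^sub>\<infinity>j\<in>{1..}. root_exponent k j) 0 = 0"
    unfolding nth empty by simp
  show "of_nat (mdeg a) * mfps_nth (\<Sum>\<^sub>\<infinity>j\<in>{1..}. root_exponent k j) a = mfps_nth (cycle_term k (mdeg a)) a"
    if a: "a \<noteq> 0"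
  proof -
    have "mdeg a \<noteq> 0" using a by simp
    \<comment> \<open>The one relevant index lies in the range of summation, which starts at
      1.\<close>
    then have j: "1 \<le> ?j a"
      by (metis One_nat_def Suc_leI dvd_div_eq_0_iff gcd_dvd1 neq0_conv)
    have "(\<Sum>j\<in>?N a. mfps_nth (root_exponent k j) a) = (\<Sum>j\<in>{?j a}. mfps_nth (root_exponent k j) a)"
      by (rule sum.mono_neutral_left) (use sub[OF a] j in auto)
    then show ?thesis
      unfolding nth using nth_root_exponent[OF k a j] by simp
  qed
qed

theorem theorem6p7:
  fixes k :: nat
  assumes "k > 0"
  shows "(\<Sum>\<^sub>\<infinity>n\<in>(UNIV :: nat set). \<Sum>\<mu>\<in>bipartitions n.
            mfps_const (of_int (B_class_sroots k n \<mu>) / of_nat (B_class_centralizer_order n \<mu>))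
              * tmonom \<mu>)
       = mfps_exp (\<Sum>\<^sub>\<infinity>j\<in>{1::nat..}. \<Sum>\<theta>\<in>Z2. \<Sum>h | h dvd k \<and> gcd h j = 1.
            mfps_const (of_int (Z2_sroots h \<theta>) / of_nat (2 * j * (k div h)))
              * tvar j \<theta> ^ (j * (k div h)))"
proof -
  let ?P = "group_average k" and ?C = "cycle_term k"
  define E where "E = (\<Sum>\<^sub>\<infinity>j\<in>{1..}. root_exponent k j)"
  define G where "G = (\<Sum>\<^sub>\<infinity>n\<in>UNIV. ?P n)"
  have P_zero: "mfps_nth (?P n) m = 0" if "mdeg m \<noteq> n" for n m
    by (rule homogeneous_nth[OF homogeneous_group_average that])
  have C_zero: "mfps_nth (?C l) a = 0" if "mdeg a \<noteq> l" for l a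
    by (rule homogeneous_nth[OF homogeneous_cycle_term that])
  \<comment> \<open>By homogeneity a monomial is met only by the average whose index is its degree;
    this gives convergence and the coefficients of the sum at once.\<close>
  have sub: "{n \<in> UNIV. mfps_nth (?P n) m \<noteq> 0} \<subseteq> {mdeg m}" for m
  proof
    fix n assume "n \<in> {n \<in> UNIV. mfps_nth (?P n) m \<noteq> 0}"
    then show "n \<in> {mdeg m}" using P_zero[of m n] by auto
  qed
  have "(?P has_sum Abs_mfps (\<lambda>m. \<Sum>n | n \<in> UNIV \<and> mfps_nth (?P n) m \<noteq> 0. mfps_nth (?P n) m)) UNIV"
    by (rule has_sum_mfps) (rule finite_subset[OF sub], simp)
  then have "mfps_nth G m = (\<Sum>n | n \<in> UNIV \<and> mfps_nth (?P n) m \<noteq> 0. mfps_nth (?P n) m)" for m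
    by (simp add: G_def infsumI)
  moreover have "(\<Sum>n | n \<in> UNIV \<and> mfps_nth (?P n) m \<noteq> 0. mfps_nth (?P n) m)
      = (\<Sum>n\<in>{mdeg m}. mfps_nth (?P n) m)" for m
    by (rule sum.mono_neutral_left) (use sub[of m] in auto)
  ultimately have G_nth: "mfps_nth G m = mfps_nth (?P (mdeg m)) m" for m
    by simp
  note E = euler_exponent[OF assms, folded E_def]
  have "euler G = euler E * G"
  proof (rule mfps_eqI)
    fix m :: "nat \<times> int \<Rightarrow>\<^sub>0 nat"
    let ?n = "mdeg m"
    have "mfps_nth (euler G) m = mfps_nth (mfps_const (of_nat ?n) * ?P ?n) m"
      by (simp add: G_nth)
    also have "\<dots> = (\<Sum>l = 1..?n. \<Sum>(a, b)\<in>splittings m. mfps_nth (?C l) a * mfps_nth (?P (?n - l)) b)"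
      by (simp only: group_average_rec mfps_nth_sum mfps_nth_mult)
    also have "\<dots> = (\<Sum>(a, b)\<in>splittings m. \<Sum>l = 1..?n. mfps_nth (?C l) a * mfps_nth (?P (?n - l)) b)"
      by (subst sum.swap) (simp add: case_prod_unfold)
    also have "\<dots> = (\<Sum>(a, b)\<in>splittings m. mfps_nth (euler E) a * mfps_nth G b)"
    proof (rule sum.cong, simp, clarify)
      fix a b assume ab: "(a, b) \<in> splittings m"
      then have n: "?n = mdeg a + mdeg b" by (auto simp: splittings_def mdeg_add)
      show "(\<Sum>l = 1..?n. mfps_nth (?C l) a * mfps_nth (?P (?n - l)) b) = mfps_nth (euler E) a * mfps_nth G b"
      proof (cases "a = 0")
        \<comment> \<open>Both sides vanish: the cycle terms start at l = 1 and have no constant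
          term, and the Euler operator annihilates that of \<open>E\<close>.\<close>
        case True
        then have "mfps_nth (?C l) a = 0" if "l \<in> {1..?n}" for l using that by (intro C_zero) auto
        then show ?thesis using True by simp
      next
        case False
        then have a: "1 \<le> mdeg a" using mdeg_eq_0_iff[of a] by linarith
        \<comment> \<open>Homogeneity leaves only l equal to the degree of \<open>a\<close>, and
          then ?n - l is the degree of \<open>b\<close>, as the coefficient of \<open>G\<close> at
          \<open>b\<close> requires.\<close>
        have "(\<Sum>l = 1..?n. mfps_nth (?C l) a * mfps_nth (?P (?n - l)) b)
            = (\<Sum>l\<in>{mdeg a}. mfps_nth (?C l) a * mfps_nth (?P (?n - l)) b)"
          by (rule sum.mono_neutral_right) (use C_zero a n in auto)
        then show ?thesis using E(2)[OF False] by (simp add: G_nth n)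
      qed
    qed
    also have "\<dots> = mfps_nth (euler E * G) m" by (rule mfps_nth_mult[symmetric])
    finally show "mfps_nth (euler G) m = mfps_nth (euler E * G) m" .
  qed
  then have "G = mfps_exp E"
    by (intro mfps_exp_unique E(1)) (simp add: G_nth group_average_0 mfps_nth_1)
  then show ?thesis
    unfolding G_def E_def root_exponent_def group_average_def class_sum_eq_weight_sum .
qed

end
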